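(* Let $\mathcal{O}^1$ be an oriented matroid of rank $r$ on ground set $E$, let $f\ne g\in E$ be elements in general position, and let $X$ be a cocircuit of $\mathcal{O}^1$ with $X_g=+$ and $X_f\ne0$. Let $\mathcal{O}^1\cup f'$ be a single-element extension parallel to $f$ with respect to $g$ with $X_{f'}=0$, let $\mathcal{O}^2=(\mathcal{O}^1\cup f')\setminus f$, and let $\mathcal{O}^3=\mathcal{O}^2\setminus(\mathrm{supp}(X)\setminus\{g\})$ (the deletion of all elements of $\mathrm{supp}(X)$ other than $g$; here $\mathrm{supp}(X)$ is taken in $\mathcal{O}^2$, so $f'\in\mathcal{O}^3$). If $\mathcal{O}^1$ is Euclidean, then $\mathcal{O}^3$ is Euclidean. If $(\mathcal{O}^1,e,f)$ is a Euclidean oriented matroid program for some $e\in z(X)$, then $(\mathcal{O}^3\setminus g,e,f')$ is a Euclidean oriented matroid program.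
   Context: Oriented matroids are given by covectors in $\{+,-,0\}^E$; cocircuits are minimal nonzero covectors; $\mathrm{supp}(X)=\{e:X_e\ne0\}$, $z(X)=\{e:X_e=0\}$, $\mathrm{sep}(X,Y)=\{e:X_e=-Y_e\ne0\}$, conformal means $\mathrm{sep}=\emptyset$. Cocircuits $X\ne\pm Y$ are comodular if $z(X\circ Y)$ is a flat of rank (rank minus 2); elimination of $e\in\mathrm{sep}(X,Y)$ yields the unique cocircuit $Z$ with $Z_e=0$, $\mathrm{supp}(Z)\subseteq\mathrm{supp}(X\circ Y)\setminus\{e\}$. An oriented matroid program $(\mathcal{O},g,f)$: distinct $g,f$, $g$ not a loop, $f$ not a coloop. For comodular cocircuits $X,Y$ with $X_g=Y_g\ne0$ and $Z$ the elimination of $g$ between $-X$ and $Y$: $X\to Y$, $X\leftarrow Y$, undirected according as $Z_f=+,-,0$. $G_f$: vertices cocircuits with $g=+$, edges conformal comodular pairs, directed so; the program is Euclidean if $G_f$ has no directed cycle; an oriented matroid is Euclidean if all its programs are. An element $f$ is in general position in a rank-$r$ oriented matroid if $f\notin\mathrm{cl}(S)$ for all $S$ not containing $f$ of rank $<r$. A single-element extension $\mathcal{O}\cup f'$ is parallel to $f$ with respect to $g$ if every cocircuit $Y$ of $\mathcal{O}\cup f'$ with $Y_g=0$ satisfies $Y_{f'}=Y_f$. *)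

theory Defs
  imports Main
begin

text \<open>Signs are the integers -1, 0, 1. A sign vector on a ground set is a function on the whole
  type that vanishes outside the ground set, so that sign vectors are determined by their
  entries on the ground set.\<close>

type_synonym 'a svec = "'a \<Rightarrow> int"

definition sign_vectors :: "'a set \<Rightarrow> 'a svec set" where
  "sign_vectors E = {X. (\<forall>e. X e \<in> {-1, 0, 1}) \<and> (\<forall>e. e \<notin> E \<longrightarrow> X e = 0)}"

definition supp :: "'a svec \<Rightarrow> 'a set" where
  "supp X = {e. X e \<noteq> 0}"

definition sep :: "'a svec \<Rightarrow> 'a svec \<Rightarrow> 'a set" where
  "sep X Y = {e. X e = - Y e \<and> X e \<noteq> 0}"

definition conformal :: "'a svec \<Rightarrow> 'a svec \<Rightarrow> bool" where
  "conformal X Y \<longleftrightarrow> sep X Y = {}"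

definition scomp :: "'a svec \<Rightarrow> 'a svec \<Rightarrow> 'a svec" where
  "scomp X Y = (\<lambda>e. if X e \<noteq> 0 then X e else Y e)"

definition srestrict :: "'a set \<Rightarrow> 'a svec \<Rightarrow> 'a svec" where
  "srestrict A X = (\<lambda>e. if e \<in> A then X e else 0)"

record 'a orimat =
  ground :: "'a set"
  covectors :: "'a svec set"

text \<open>The covector axioms; in the last one, the required vector agrees with the composition
  off the separation set and vanishes at the eliminated element.\<close>

definition oriented_matroid :: "'a orimat \<Rightarrow> bool" where
  "oriented_matroid M \<longleftrightarrow>
     finite (ground M) \<and>
     covectors M \<subseteq> sign_vectors (ground M) \<and>
     (\<lambda>_. 0) \<in> covectors M \<and>
     (\<forall>X\<in>covectors M. - X \<in> covectors M) \<and>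
     (\<forall>X\<in>covectors M. \<forall>Y\<in>covectors M. scomp X Y \<in> covectors M) \<and>
     (\<forall>X\<in>covectors M. \<forall>Y\<in>covectors M. \<forall>e\<in>sep X Y.
        \<exists>Z\<in>covectors M. Z e = 0 \<and> (\<forall>h\<in>ground M - sep X Y. Z h = scomp X Y h))"

definition zeros :: "'a orimat \<Rightarrow> 'a svec \<Rightarrow> 'a set" where
  "zeros M X = {e \<in> ground M. X e = 0}"

text \<open>Minimality is with respect to inclusion of supports.\<close>

definition cocircuits :: "'a orimat \<Rightarrow> 'a svec set" where
  "cocircuits M = {X \<in> covectors M. supp X \<noteq> {} \<and>
     (\<forall>Y\<in>covectors M. supp Y \<noteq> {} \<and> supp Y \<subseteq> supp X \<longrightarrow> supp Y = supp X)}"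

text \<open>The underlying matroid: its flats are the zero sets of the covectors, so the closure of
  \<open>S\<close> is the intersection of the zero sets containing \<open>S\<close>.\<close>

definition closure :: "'a orimat \<Rightarrow> 'a set \<Rightarrow> 'a set" where
  "closure M S = {e \<in> ground M. \<forall>X\<in>covectors M. (\<forall>s\<in>S. X s = 0) \<longrightarrow> X e = 0}"

definition flat :: "'a orimat \<Rightarrow> 'a set \<Rightarrow> bool" where
  "flat M F \<longleftrightarrow> F \<subseteq> ground M \<and> closure M F = F"

definition indep :: "'a orimat \<Rightarrow> 'a set \<Rightarrow> bool" where
  "indep M I \<longleftrightarrow> I \<subseteq> ground M \<and> (\<forall>e\<in>I. e \<notin> closure M (I - {e}))"

definition rank_of :: "'a orimat \<Rightarrow> 'a set \<Rightarrow> nat" where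
  "rank_of M S = Max (card ` {I. I \<subseteq> S \<and> indep M I})"

definition om_rank :: "'a orimat \<Rightarrow> nat" where
  "om_rank M = rank_of M (ground M)"

definition loop :: "'a orimat \<Rightarrow> 'a \<Rightarrow> bool" where
  "loop M e \<longleftrightarrow> e \<in> closure M {}"

definition coloop :: "'a orimat \<Rightarrow> 'a \<Rightarrow> bool" where
  "coloop M e \<longleftrightarrow> e \<in> ground M \<and> e \<notin> closure M (ground M - {e})"

definition general_position :: "'a orimat \<Rightarrow> 'a \<Rightarrow> bool" where
  "general_position M f \<longleftrightarrow> f \<in> ground M \<and>
     (\<forall>S. S \<subseteq> ground M \<and> f \<notin> S \<and> rank_of M S < om_rank M \<longrightarrow> f \<notin> closure M S)"

definition deletion :: "'a orimat \<Rightarrow> 'a set \<Rightarrow> 'a orimat" where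
  "deletion M A = \<lparr>ground = ground M - A, covectors = srestrict (ground M - A) ` covectors M\<rparr>"

definition single_element_extension :: "'a orimat \<Rightarrow> 'a \<Rightarrow> 'a orimat \<Rightarrow> bool" where
  "single_element_extension M p N \<longleftrightarrow>
     oriented_matroid N \<and> p \<notin> ground M \<and> ground N = insert p (ground M) \<and> deletion N {p} = M"

definition parallel_extension :: "'a orimat \<Rightarrow> 'a \<Rightarrow> 'a orimat \<Rightarrow> 'a \<Rightarrow> 'a \<Rightarrow> bool" where
  "parallel_extension M p N f g \<longleftrightarrow>
     single_element_extension M p N \<and> (\<forall>Y\<in>cocircuits N. Y g = 0 \<longrightarrow> Y p = Y f)"

definition comodular :: "'a orimat \<Rightarrow> 'a svec \<Rightarrow> 'a svec \<Rightarrow> bool" where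
  "comodular M X Y \<longleftrightarrow>
     X \<in> cocircuits M \<and> Y \<in> cocircuits M \<and> X \<noteq> Y \<and> X \<noteq> - Y \<and>
     flat M (zeros M (scomp X Y)) \<and> rank_of M (zeros M (scomp X Y)) + 2 = om_rank M"

text \<open>The support condition and \<open>Z e = 0\<close> determine the eliminating cocircuit of a comodular pair
  only up to sign; agreement with the composition off the separation set selects the sign.\<close>

definition elimination :: "'a orimat \<Rightarrow> 'a svec \<Rightarrow> 'a svec \<Rightarrow> 'a \<Rightarrow> 'a svec \<Rightarrow> bool" where
  "elimination M X Y e Z \<longleftrightarrow>
     e \<in> sep X Y \<and> Z \<in> cocircuits M \<and> Z e = 0 \<and> supp Z \<subseteq> supp (scomp X Y) - {e} \<and>
     (\<forall>h\<in>ground M - sep X Y. Z h = scomp X Y h)"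

definition om_program :: "'a orimat \<Rightarrow> 'a \<Rightarrow> 'a \<Rightarrow> bool" where
  "om_program M g f \<longleftrightarrow>
     oriented_matroid M \<and> g \<in> ground M \<and> f \<in> ground M \<and> g \<noteq> f \<and> \<not> loop M g \<and> \<not> coloop M f"

text \<open>The orientation of a comodular pair is the sign \<open>s\<close>: \<open>1\<close> for \<open>X \<rightarrow> Y\<close>, \<open>-1\<close> for
  \<open>X \<leftarrow> Y\<close>, and \<open>0\<close> for an undirected pair. Exchanging \<open>X\<close> and \<open>Y\<close> negates \<open>Z\<close> and
  hence \<open>s\<close>.\<close>

definition orientation :: "'a orimat \<Rightarrow> 'a \<Rightarrow> 'a \<Rightarrow> 'a svec \<Rightarrow> 'a svec \<Rightarrow> int \<Rightarrow> bool" where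
  "orientation M g f X Y s \<longleftrightarrow>
     comodular M X Y \<and> X g = Y g \<and> X g \<noteq> 0 \<and> (\<exists>Z. elimination M (- X) Y g Z \<and> Z f = s)"

definition Gf_vertices :: "'a orimat \<Rightarrow> 'a \<Rightarrow> 'a svec set" where
  "Gf_vertices M g = {X \<in> cocircuits M. X g = 1}"

definition Gf_edge :: "'a orimat \<Rightarrow> 'a \<Rightarrow> 'a svec \<Rightarrow> 'a svec \<Rightarrow> bool" where
  "Gf_edge M g X Y \<longleftrightarrow>
     X \<in> Gf_vertices M g \<and> Y \<in> Gf_vertices M g \<and> conformal X Y \<and> comodular M X Y"

text \<open>The graph is only partially directed. As usual for oriented matroid programs, a cycle is
  directed if it has at least one directed edge and all its directed edges point the same way
  around the cycle; it may contain undirected edges. The cycle is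
  \<open>P 0, P 1, ..., P (n - 1), P n = P 0\<close>; the orientation conditions exclude \<open>n \<le> 2\<close>.\<close>

definition directed_cycle ::
    "'a orimat \<Rightarrow> 'a \<Rightarrow> 'a \<Rightarrow> (nat \<Rightarrow> 'a svec) \<Rightarrow> nat \<Rightarrow> bool" where
  "directed_cycle M g f P n \<longleftrightarrow>
     inj_on P {..<n} \<and> P n = P 0 \<and>
     (\<forall>i<n. Gf_edge M g (P i) (P (Suc i)) \<and>
        (orientation M g f (P i) (P (Suc i)) 1 \<or> orientation M g f (P i) (P (Suc i)) 0)) \<and>
     (\<exists>i<n. orientation M g f (P i) (P (Suc i)) 1)"

definition euclidean_program :: "'a orimat \<Rightarrow> 'a \<Rightarrow> 'a \<Rightarrow> bool" where
  "euclidean_program M g f \<longleftrightarrow> om_program M g f \<and> (\<nexists>P n. directed_cycle M g f P n)"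

definition euclidean_om :: "'a orimat \<Rightarrow> bool" where
  "euclidean_om M \<longleftrightarrow>
     oriented_matroid M \<and> (\<forall>g f. om_program M g f \<longrightarrow> euclidean_program M g f)"

end

theory Submission
  imports Defs
begin

text \<open>In the contraction by \<open>g\<close> the elements \<open>f\<close> and \<open>f'\<close> are parallel, and \<open>g\<close> is a coloop of
  \<open>\<O>\<^sup>3\<close> because all other elements lie in the hyperplane \<open>z(X)\<close>. Hence, after renaming \<open>f'\<close> to \<open>f\<close>,
  \<open>\<O>\<^sup>3 \ g\<close> is the restriction of \<open>\<O>\<^sup>1 / g\<close> to \<open>z(X) \<union> f\<close>, a minor of full rank \<open>r - 1\<close>.
  Cocircuits and comodular pairs of this minor lift to those of \<open>\<O>\<^sup>1\<close> with the same
  orientation. A lifted edge need not be conformal, but eliminating separating elements subdivides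
  it into a directed walk along the coline, so a directed cycle of the minor yields a directed
  closed walk, and hence a directed cycle, in \<open>\<O>\<^sup>1\<close>. Programs \<open>(\<O>\<^sup>3, g, b)\<close> are trivially Euclidean,
  their graph having a single vertex.\<close>

section \<open>Covector elimination\<close>

locale oriented_mat =
  fixes M :: "'a orimat"
  assumes om: "oriented_matroid M"
begin

lemma finite_ground: "finite (ground M)"
  using om by (simp add: oriented_matroid_def)

lemma covector_sign: "X \<in> covectors M \<Longrightarrow> X e = -1 \<or> X e = 0 \<or> X e = 1"
  using om unfolding oriented_matroid_def sign_vectors_def by blast

lemma covector_outside: "X \<in> covectors M \<Longrightarrow> e \<notin> ground M \<Longrightarrow> X e = 0"
  using om unfolding oriented_matroid_def sign_vectors_def by blast

lemma covector_uminus: "X \<in> covectors M \<Longrightarrow> - X \<in> covectors M"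
  using om unfolding oriented_matroid_def by blast

lemma covector_scomp: "X \<in> covectors M \<Longrightarrow> Y \<in> covectors M \<Longrightarrow> scomp X Y \<in> covectors M"
  using om unfolding oriented_matroid_def by blast

lemma covector_zero: "(\<lambda>_. 0) \<in> covectors M"
  using om unfolding oriented_matroid_def by blast

text \<open>All covectors vanish outside the ground set, so the agreement clause of the axiom
  extends to every index. With \<open>sep\<close> unfolded, no ground-set side conditions
  remain.\<close>

lemma eliminate:
  assumes "X \<in> covectors M" "Y \<in> covectors M" "X e = - Y e" "X e \<noteq> 0"
  obtains Z where "Z \<in> covectors M" "Z e = 0"
    "\<And>h. \<not> (X h = - Y h \<and> X h \<noteq> 0) \<Longrightarrow> Z h = scomp X Y h"
proof -
  have "e \<in> sep X Y" using assms by (simp add: sep_def)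
  then obtain Z where Z: "Z \<in> covectors M" "Z e = 0"
      "\<forall>h\<in>ground M - sep X Y. Z h = scomp X Y h"
    using om assms unfolding oriented_matroid_def by blast
  have "Z h = scomp X Y h" if "\<not> (X h = - Y h \<and> X h \<noteq> 0)" for h
  proof (cases "h \<in> ground M")
    case True
    then show ?thesis using Z that by (auto simp: sep_def)
  next
    case False
    then have "X h = 0" "Y h = 0" "Z h = 0" using Z(1) assms(1,2) covector_outside by blast+
    then show ?thesis by (simp add: scomp_def)
  qed
  with Z that show thesis by blast
qed

text \<open>Replacing \<open>Y\<close> by \<open>- Y\<close> when the signs at \<open>e\<close>
  agree makes elimination applicable. Only zero patterns survive this, which is all that the
  unsigned matroid arguments need.\<close>

lemma eliminate_up_to_sign:
  assumes X: "X \<in> covectors M" and Y: "Y \<in> covectors M" and "X e \<noteq> 0" "Y e \<noteq> 0"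
  shows "\<exists>Z\<in>covectors M. Z e = 0 \<and> (\<forall>h. X h = 0 \<longrightarrow> Y h = 0 \<longrightarrow> Z h = 0) \<and>
    (\<forall>h. (X h = 0) \<noteq> (Y h = 0) \<longrightarrow> Z h \<noteq> 0)"
proof -
  obtain Y' where Y': "Y' \<in> covectors M" "X e = - Y' e" "\<And>h. Y' h = 0 \<longleftrightarrow> Y h = 0"
  proof (cases "X e = - Y e")
    case True
    then show thesis using that Y by blast
  next
    case False
    then have "X e = Y e"
      using covector_sign[OF X, of e] covector_sign[OF Y, of e] assms by auto
    then show thesis using that[of "- Y"] covector_uminus[OF Y] by simp
  qed
  obtain Z where Z: "Z \<in> covectors M" "Z e = 0"
      "\<And>h. \<not> (X h = - Y' h \<and> X h \<noteq> 0) \<Longrightarrow> Z h = scomp X Y' h"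
    using eliminate[OF X Y'(1,2) \<open>X e \<noteq> 0\<close>] by blast
  show ?thesis
    by (rule bexI[OF _ Z(1)]) (use Z(2,3) Y'(3) in \<open>auto simp: scomp_def\<close>)
qed

section \<open>Cocircuits and conformal reduction\<close>

lemma cocircuit_covector: "X \<in> cocircuits M \<Longrightarrow> X \<in> covectors M"
  by (simp add: cocircuits_def)

lemma cocircuit_uminus:
  assumes "X \<in> cocircuits M"
  shows "- X \<in> cocircuits M"
proof -
  have "supp (- X) = supp X" by (simp add: supp_def)
  with assms show ?thesis by (simp add: cocircuits_def covector_uminus)
qed

text \<open>The working form of minimality: a nonzero \<open>V\<close> would have the same support
  as \<open>X\<close>, which position \<open>e\<close> rules out.\<close>

lemma cocircuit_minimal:
  assumes "X \<in> cocircuits M" "V \<in> covectors M" "\<And>h. X h = 0 \<Longrightarrow> V h = 0"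
    and "X e \<noteq> 0" "V e = 0"
  shows "V h = 0"
proof (rule ccontr)
  assume "V h \<noteq> 0"
  then have "supp V \<noteq> {}" "supp V \<subseteq> supp X" using assms by (auto simp: supp_def)
  then have "supp V = supp X" using assms unfolding cocircuits_def by blast
  with assms show False by (auto simp: supp_def)
qed

lemma cocircuitI:
  assumes "X \<in> covectors M" "X e \<noteq> 0"
    and "\<And>V h k. \<lbrakk>V \<in> covectors M; \<And>h. X h = 0 \<Longrightarrow> V h = 0; V h \<noteq> 0; X k \<noteq> 0\<rbrakk> \<Longrightarrow> V k \<noteq> 0"
  shows "X \<in> cocircuits M"
proof -
  have "supp V = supp X" if V: "V \<in> covectors M" "supp V \<noteq> {}" "supp V \<subseteq> supp X" for V
  proof -
    obtain h where "V h \<noteq> 0" using V(2) by (auto simp: supp_def)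
    then have "X k \<noteq> 0 \<Longrightarrow> V k \<noteq> 0" for k
      using assms(3)[of V h k] V(1,3) by (auto simp: supp_def)
    with V(3) show ?thesis by (auto simp: supp_def)
  qed
  moreover have "supp X \<noteq> {}" using assms(2) by (auto simp: supp_def)
  ultimately show ?thesis using assms(1) unfolding cocircuits_def by blast
qed

text \<open>Otherwise the signs are opposite at some \<open>e\<close> and equal and nonzero at some
  \<open>k\<close>. Eliminating \<open>e\<close> gives a covector that is zero by minimality, yet
  keeps its entry at \<open>k\<close>.\<close>

lemma cocircuits_same_support:
  assumes X: "X \<in> cocircuits M" and Y: "Y \<in> cocircuits M" and same: "\<And>h. X h = 0 \<longleftrightarrow> Y h = 0"
  shows "X = Y \<or> X = - Y"
proof (rule ccontr)
  assume "\<not> ?thesis"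
  then obtain e k where e: "X e \<noteq> Y e" and k: "X k \<noteq> - Y k" by (auto simp: fun_eq_iff)
  note s = covector_sign[OF cocircuit_covector[OF X]] covector_sign[OF cocircuit_covector[OF Y]]
  have e': "X e = - Y e" "X e \<noteq> 0" using e s(1)[of e] s(2)[of e] same[of e] by auto
  have k': "X k \<noteq> 0" using k same[of k] by auto
  obtain Z where Z: "Z \<in> covectors M" "Z e = 0"
      "\<And>h. \<not> (X h = - Y h \<and> X h \<noteq> 0) \<Longrightarrow> Z h = scomp X Y h"
    using eliminate[OF cocircuit_covector[OF X] cocircuit_covector[OF Y] e'] by blast
  have "Z k = 0"
    by (rule cocircuit_minimal[OF X Z(1) _ e'(2) Z(2)]) (use Z(3) same in \<open>auto simp: scomp_def\<close>)
  with Z(3)[of k] k k' show False by (simp add: scomp_def)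
qed

text \<open>Eliminating repeatedly between \<open>Y\<close> and \<open>W\<close> shrinks the separation set until the result
  is conformal to \<open>Y\<close>.\<close>

lemma conformal_reduction:
  assumes "Y \<in> covectors M" "W \<in> covectors M" "\<And>h. Y h = 0 \<Longrightarrow> W h = 0"
    and "Y e = - W e" "Y e \<noteq> 0"
  shows "\<exists>Z k. Z \<in> covectors M \<and> (\<forall>h. Z h \<noteq> 0 \<longrightarrow> Z h = Y h) \<and>
     (\<forall>h. \<not> (Y h = - W h \<and> Y h \<noteq> 0) \<longrightarrow> Z h = Y h) \<and> Y k \<noteq> 0 \<and> Z k = 0"
  using assms
proof (induction "card (sep Y W)" arbitrary: W e rule: less_induct)
  case less
  obtain Z where Z: "Z \<in> covectors M" "Z e = 0"
      "\<And>h. \<not> (Y h = - W h \<and> Y h \<noteq> 0) \<Longrightarrow> Z h = scomp Y W h"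
    using eliminate less.prems(1,2,4,5) by blast
  have ZY: "Z h = Y h" if "\<not> (Y h = - W h \<and> Y h \<noteq> 0)" for h
    using Z(3)[OF that] less.prems(3)[of h] by (simp add: scomp_def)
  show ?case
  proof (cases "sep Y Z = {}")
    case True
    have "Z h = Y h" if "Z h \<noteq> 0" for h
    proof (cases "Y h = 0")
      case True
      then show ?thesis using ZY[of h] by simp
    next
      case False
      have "Y h \<noteq> - Z h" using \<open>sep Y Z = {}\<close> False by (auto simp: sep_def)
      then show ?thesis
        using that False covector_sign[OF Z(1), of h] covector_sign[OF less.prems(1), of h] by auto
    qed
    then show ?thesis using Z ZY less.prems(5) by blast
  next
    case False
    then obtain e' where e': "Y e' = - Z e'" "Y e' \<noteq> 0" by (auto simp: sep_def)
    have sub: "Y h = - W h \<and> Y h \<noteq> 0" if "Y h = - Z h \<and> Y h \<noteq> 0" for h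
      using ZY[of h] that by auto
    have "sep Y Z \<subseteq> sep Y W" using sub unfolding sep_def by blast
    moreover have "e \<in> sep Y W" using less.prems(4,5) unfolding sep_def by blast
    moreover have "e \<notin> sep Y Z" using less.prems(5) Z(2) by (simp add: sep_def)
    moreover have "finite (sep Y W)"
      by (rule finite_subset[OF _ finite_ground])
        (use covector_outside[OF less.prems(1)] in \<open>auto simp: sep_def\<close>)
    ultimately have "card (sep Y Z) < card (sep Y W)"
      by (metis psubsetI psubset_card_mono)
    moreover have "Y h = 0 \<Longrightarrow> Z h = 0" for h using ZY[of h] by simp
    ultimately obtain Z' k where "Z' \<in> covectors M" "\<forall>h. Z' h \<noteq> 0 \<longrightarrow> Z' h = Y h"
      "\<forall>h. \<not> (Y h = - Z h \<and> Y h \<noteq> 0) \<longrightarrow> Z' h = Y h" "Y k \<noteq> 0" "Z' k = 0"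
      using less.hyps[OF _ less.prems(1) Z(1) _ e'] by blast
    then show ?thesis using sub by blast
  qed
qed

text \<open>Induction on the size of the support: if \<open>V\<close> is not a cocircuit, some
  nonzero covector has strictly smaller support, and from it a smaller covector is built that is
  conformal to \<open>V\<close> and nonzero at \<open>e\<close>.\<close>

lemma conformal_cocircuit:
  assumes "V \<in> covectors M" "V e \<noteq> 0"
  obtains Y where "Y \<in> cocircuits M" "\<And>h. Y h \<noteq> 0 \<Longrightarrow> Y h = V h" "Y e \<noteq> 0"
proof -
  have "\<exists>Y\<in>cocircuits M. (\<forall>h. Y h \<noteq> 0 \<longrightarrow> Y h = V h) \<and> Y e \<noteq> 0"
    using assms
  proof (induction "card (supp V)" arbitrary: V rule: less_induct)
    case less
    note V = less.prems(1)
    show ?case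
    proof (cases "V \<in> cocircuits M")
      case True
      with less.prems show ?thesis by blast
    next
      case False
      then obtain W0 h0 k where W0: "W0 \<in> covectors M" "\<And>h. V h = 0 \<Longrightarrow> W0 h = 0"
          "W0 h0 \<noteq> 0" "V k \<noteq> 0" "W0 k = 0"
        using cocircuitI[OF less.prems] by meson
      have smaller: ?thesis if Z: "Z \<in> covectors M" "\<And>h. Z h \<noteq> 0 \<Longrightarrow> Z h = V h"
          "Z e \<noteq> 0" "V k \<noteq> 0" "Z k = 0" for Z k
      proof -
        have "supp Z \<subseteq> supp V" using Z(2) by (fastforce simp: supp_def)
        moreover have "k \<in> supp V" "k \<notin> supp Z" using Z(4,5) by (auto simp: supp_def)
        moreover have "finite (supp V)"
          by (rule finite_subset[OF _ finite_ground])
            (use covector_outside[OF V] in \<open>auto simp: supp_def\<close>)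
        ultimately have "card (supp Z) < card (supp V)" by (metis psubsetI psubset_card_mono)
        then obtain Y where "Y \<in> cocircuits M" "\<forall>h. Y h \<noteq> 0 \<longrightarrow> Y h = Z h" "Y e \<noteq> 0"
          using less.hyps Z(1,3) by blast
        then show ?thesis using Z(2) by (metis)
      qed
      \<comment> \<open>The sign of \<open>W\<close> is chosen so that \<open>W\<close> agrees with
        \<open>V\<close> at \<open>e\<close> if it is nonzero there, and otherwise opposes
        \<open>V\<close> at \<open>h0\<close>, so that a separating element exists for the
        reduction.\<close>
      define \<sigma> where "\<sigma> = (if W0 e \<noteq> 0 then W0 e = V e else W0 h0 = - V h0)"
      define W where "W = (if \<sigma> then W0 else - W0)"
      have W: "W \<in> covectors M" "\<And>h. V h = 0 \<Longrightarrow> W h = 0" "W k = 0" "\<And>h. W h = 0 \<longleftrightarrow> W0 h = 0"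
        using W0 covector_uminus by (auto simp: W_def)
      note s = covector_sign[OF V] covector_sign[OF W0(1)]
      have We: "W e \<noteq> 0 \<Longrightarrow> W e = V e"
        using s[of e] less.prems(2) W(4)[of e] by (auto simp: W_def \<sigma>_def)
      have Wh: "W e = 0 \<Longrightarrow> V h0 = - W h0 \<and> V h0 \<noteq> 0"
        using s[of h0] W0(2)[of h0] W0(3) by (auto simp: W_def \<sigma>_def split: if_splits)
      show ?thesis
      proof (cases "\<exists>h. V h = - W h \<and> V h \<noteq> 0")
        case True
        then obtain h where "V h = - W h" "V h \<noteq> 0" by blast
        from conformal_reduction[OF V W(1,2) this]
        obtain Z k' where Z: "Z \<in> covectors M" "\<forall>h. Z h \<noteq> 0 \<longrightarrow> Z h = V h"
          "\<forall>h. \<not> (V h = - W h \<and> V h \<noteq> 0) \<longrightarrow> Z h = V h" "V k' \<noteq> 0" "Z k' = 0"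
          by blast
        \<comment> \<open>Since \<open>W e\<close> is \<open>0\<close> or \<open>V e\<close>, the
          element \<open>e\<close> is not separated and the reduction keeps its entry.\<close>
        have "Z e = V e" using Z(3) We less.prems(2) by (metis neg_equal_zero)
        then have "Z e \<noteq> 0" using less.prems(2) by simp
        then show ?thesis using smaller[of Z k'] Z(1,2,4,5) by blast
      next
        case False
        then have "W e \<noteq> 0" using Wh by blast
        moreover have "W h = V h" if "W h \<noteq> 0" for h
        proof -
          have "V h \<noteq> 0" using W(2) that by blast
          then have "V h \<noteq> - W h" using False by blast
          then show ?thesis
            using that \<open>V h \<noteq> 0\<close> covector_sign[OF V, of h] covector_sign[OF W(1), of h] by auto
        qed
        ultimately show ?thesis using smaller[of W k] W W0(4) by blast
      qed
    qed
  qed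
  then show thesis using that by blast
qed

subsection \<open>Closure and rank\<close>

lemma closure_mono: "S \<subseteq> T \<Longrightarrow> closure M S \<subseteq> closure M T"
  by (auto simp: closure_def)

lemma subset_closure: "S \<subseteq> ground M \<Longrightarrow> S \<subseteq> closure M S"
  by (auto simp: closure_def)

lemma closure_subset_ground: "closure M S \<subseteq> ground M"
  by (auto simp: closure_def)

lemma closure_minimal: "S \<subseteq> closure M T \<Longrightarrow> closure M S \<subseteq> closure M T"
  unfolding closure_def by blast

text \<open>If it failed, there would be covectors vanishing on \<open>S\<close>, one of them zero
  at \<open>x\<close> but not at \<open>e\<close>, the other nonzero at both. Eliminating
  \<open>e\<close> gives a covector vanishing on \<open>insert e S\<close> but not at
  \<open>x\<close>.\<close>

lemma closure_exchange:
  assumes x: "x \<in> closure M (insert e S)" "x \<notin> closure M S" and e: "e \<in> ground M"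
  shows "e \<in> closure M (insert x S)"
proof (rule ccontr)
  assume "\<not> ?thesis"
  then obtain V where V: "V \<in> covectors M" "\<forall>s\<in>insert x S. V s = 0" "V e \<noteq> 0"
    using e by (auto simp: closure_def)
  obtain U where U: "U \<in> covectors M" "\<forall>s\<in>S. U s = 0" "U x \<noteq> 0"
    using x by (auto simp: closure_def)
  have "U e \<noteq> 0" using U x by (auto simp: closure_def)
  obtain Z where Z: "Z \<in> covectors M" "Z e = 0" "\<forall>h. V h = 0 \<longrightarrow> U h = 0 \<longrightarrow> Z h = 0"
      "\<forall>h. (V h = 0) \<noteq> (U h = 0) \<longrightarrow> Z h \<noteq> 0"
    using eliminate_up_to_sign[OF V(1) U(1) V(3) \<open>U e \<noteq> 0\<close>] by blast
  have "\<forall>s\<in>insert e S. Z s = 0" using Z(2,3) V(2) U(2) by blast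
  then have "Z x = 0" using x(1) Z(1) unfolding closure_def by blast
  with Z(4) V(2) U(3) show False by blast
qed

lemma indep_subset: "indep M I \<Longrightarrow> J \<subseteq> I \<Longrightarrow> indep M J"
  unfolding indep_def by (meson Diff_mono closure_mono order_refl subset_iff)

lemma indep_insert:
  assumes I: "indep M I" and e: "e \<in> ground M" "e \<notin> closure M I"
  shows "indep M (insert e I)"
proof -
  have I': "I \<subseteq> ground M" using I by (simp add: indep_def)
  then have "e \<notin> I" using subset_closure e by blast
  have "x \<notin> closure M (insert e I - {x})" if "x \<in> insert e I" for x
  proof (cases "x = e")
    case True
    then show ?thesis using e \<open>e \<notin> I\<close> by simp
  next
    case False
    then have x: "x \<in> I" "x \<notin> closure M (I - {x})" using that I by (auto simp: indep_def)
    have eq: "insert e I - {x} = insert e (I - {x})" "insert x (I - {x}) = I" using False x by auto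
    show ?thesis using closure_exchange[of x e "I - {x}"] x e eq by auto
  qed
  then show ?thesis using I' e by (auto simp: indep_def)
qed

text \<open>Steinitz exchange: elements of \<open>J\<close> outside \<open>B\<close> are replaced
  one at a time by elements of \<open>B\<close>, keeping independence and cardinality.\<close>

lemma indep_card_le:
  assumes "indep M J" "J \<subseteq> closure M B" "B \<subseteq> ground M"
  shows "card J \<le> card B"
  using assms
proof (induction "card (J - B)" arbitrary: J rule: less_induct)
  case less
  have fin: "finite J" "finite B"
    using less.prems finite_ground finite_subset by (auto simp: indep_def)
  show ?case
  proof (cases "J \<subseteq> B")
    case True
    then show ?thesis using fin card_mono by blast
  next
    case False
    then obtain x where x: "x \<in> J" "x \<notin> B" by blast
    have "x \<notin> closure M (J - {x})" using x less.prems by (auto simp: indep_def)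
    \<comment> \<open>If all of \<open>B\<close> lay in the closure of \<open>J - {x}\<close>, so
      would the closure of \<open>B\<close>, and with it \<open>x\<close>.\<close>
    then obtain b where b: "b \<in> B" "b \<notin> closure M (J - {x})"
      using closure_minimal[of B "J - {x}"] x less.prems(2) by blast
    let ?J = "insert b (J - {x})"
    have "indep M ?J"
      using indep_insert[OF indep_subset[OF less.prems(1)]] b less.prems(3) by blast
    moreover have "b \<notin> J - {x}"
      using b subset_closure[of "J - {x}"] less.prems(1) by (auto simp: indep_def)
    then have "card ?J = card J" using x fin card_Suc_Diff1[of J x] by simp
    moreover have "?J \<subseteq> closure M B" using b less.prems subset_closure by blast
    moreover have "card (?J - B) < card (J - B)"
      by (rule psubset_card_mono) (use x b fin in auto)
    ultimately show ?thesis using less.hyps[of ?J] less.prems(3) by simp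
  qed
qed

lemma finite_indep_cards: "finite (card ` {I. I \<subseteq> S \<and> indep M I})"
proof -
  have "{I. I \<subseteq> S \<and> indep M I} \<subseteq> Pow (ground M)" by (auto simp: indep_def)
  then show ?thesis using finite_ground by (meson finite_Pow_iff finite_imageI finite_subset)
qed

lemma indep_rank_le:
  assumes "indep M J" "J \<subseteq> S"
  shows "card J \<le> rank_of M S"
  unfolding rank_of_def by (rule Max_ge[OF finite_indep_cards]) (use assms in blast)

text \<open>An independent subset of maximal cardinality spans, because an element outside its
  closure could be added.\<close>

lemma obtain_basis:
  assumes "S \<subseteq> ground M"
  obtains I where "I \<subseteq> S" "indep M I" "card I = rank_of M S" "S \<subseteq> closure M I"
proof -
  have "indep M {}" by (simp add: indep_def)
  then have "card ` {I. I \<subseteq> S \<and> indep M I} \<noteq> {}" by blast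
  from Max_in[OF finite_indep_cards this]
  obtain I where I: "I \<subseteq> S" "indep M I" "card I = rank_of M S"
    unfolding rank_of_def by auto
  have "S \<subseteq> closure M I"
  proof (rule ccontr)
    assume "\<not> ?thesis"
    then obtain e where e: "e \<in> S" "e \<notin> closure M I" by blast
    have "I \<subseteq> ground M" using I(1) assms by blast
    then have "e \<notin> I" "finite I"
      using e subset_closure[of I] finite_subset[OF _ finite_ground] by blast+
    moreover have "card (insert e I) \<le> rank_of M S"
      by (rule indep_rank_le[OF indep_insert]) (use I e assms in auto)
    ultimately show False using I by simp
  qed
  with I that show thesis by blast
qed

text \<open>A basis of the flat \<open>F\<close> together with \<open>e\<close> is independent,
  which bounds the rank from below, and spans the new closure, which bounds it from above.\<close>

lemma rank_closure_insert:
  assumes F: "F \<subseteq> ground M" "closure M F = F" and e: "e \<in> ground M" "e \<notin> F"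
  shows "rank_of M (closure M (insert e F)) = rank_of M F + 1"
proof -
  obtain I where I: "I \<subseteq> F" "indep M I" "card I = rank_of M F" "F \<subseteq> closure M I"
    using obtain_basis[OF F(1)] by blast
  have eI: "e \<notin> closure M I" using closure_mono[OF I(1)] F(2) e(2) by blast
  have "finite I" using I(1) F(1) finite_ground by (meson finite_subset)
  moreover have "e \<notin> I" using I(1) e(2) by blast
  ultimately have card: "card (insert e I) = rank_of M F + 1" using I(3) by simp
  have "insert e F \<subseteq> closure M (insert e F)"
    by (rule subset_closure) (use F(1) e(1) in simp)
  then have "insert e I \<subseteq> closure M (insert e F)" using I(1) by auto
  then have lower: "card (insert e I) \<le> rank_of M (closure M (insert e F))"
    by (rule indep_rank_le[OF indep_insert[OF I(2) e(1) eI]])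
  obtain J where J: "indep M J" "card J = rank_of M (closure M (insert e F))"
      "J \<subseteq> closure M (insert e F)"
    by (rule obtain_basis[OF closure_subset_ground[of "insert e F"]])
  have I': "insert e I \<subseteq> ground M" using I(1) F(1) e(1) by auto
  have "e \<in> closure M (insert e I)" using subset_closure[OF I'] by simp
  moreover have "F \<subseteq> closure M (insert e I)"
    using I(4) closure_mono[of I "insert e I"] by auto
  ultimately have "closure M (insert e F) \<subseteq> closure M (insert e I)"
    by (intro closure_minimal) simp
  with J(3) have "card J \<le> card (insert e I)" by (intro indep_card_le[OF J(1) _ I']) simp
  with lower J(2) card show ?thesis by simp
qed

text \<open>As \<open>F\<close> is closed, any basis of it is properly extended by
  \<open>e\<close>.\<close>

lemma rank_strict_mono:
  assumes F: "F \<subseteq> G" "closure M F = F" and G: "G \<subseteq> ground M" and e: "e \<in> G" "e \<notin> F"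
  shows "rank_of M F < rank_of M G"
proof -
  obtain I where I: "I \<subseteq> F" "indep M I" "card I = rank_of M F"
    using obtain_basis F G by (metis subset_trans)
  have "e \<notin> closure M I" using closure_mono[OF I(1)] F(2) e(2) by blast
  then have "card (insert e I) \<le> rank_of M G"
    by (intro indep_rank_le indep_insert I) (use I F G e in auto)
  moreover have "finite I" using I F G finite_ground by (meson finite_subset)
  moreover have "e \<notin> I" using I(1) e(2) by blast
  ultimately show ?thesis using I(3) by simp
qed

lemma closure_zeros:
  assumes "X \<in> covectors M"
  shows "closure M (zeros M X) = zeros M X"
  using assms by (auto simp: closure_def zeros_def)

text \<open>By minimality, a covector vanishing on \<open>zeros M X\<close> and at one element of
  the support is zero. Hence one further element generates the whole ground set.\<close>

lemma rank_cocircuit_zeros: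
  assumes X: "X \<in> cocircuits M"
  shows "rank_of M (zeros M X) + 1 = om_rank M"
proof -
  obtain e where e: "X e \<noteq> 0" using X by (auto simp: cocircuits_def supp_def)
  have e': "e \<in> ground M" using e covector_outside cocircuit_covector[OF X] by blast
  have "V h = 0" if V: "V \<in> covectors M" "\<forall>s\<in>insert e (zeros M X). V s = 0" for V h
  proof (rule cocircuit_minimal[OF X V(1) _ e])
    show "V k = 0" if "X k = 0" for k
      using that V(2) covector_outside[OF V(1), of k] by (auto simp: zeros_def)
    show "V e = 0" using V(2) by blast
  qed
  then have "closure M (insert e (zeros M X)) = ground M" unfolding closure_def by blast
  moreover have "rank_of M (closure M (insert e (zeros M X))) = rank_of M (zeros M X) + 1"
    by (rule rank_closure_insert[OF _ closure_zeros[OF cocircuit_covector[OF X]] e'])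
      (use e in \<open>auto simp: zeros_def\<close>)
  ultimately show ?thesis by (simp add: om_rank_def)
qed

subsection \<open>Comodular pairs\<close>

lemma comodular_sym: "comodular M X Y \<Longrightarrow> comodular M Y X"
proof -
  have "zeros M (scomp X Y) = zeros M (scomp Y X)" by (auto simp: zeros_def scomp_def)
  then show "comodular M X Y \<Longrightarrow> comodular M Y X"
    unfolding comodular_def by auto
qed

text \<open>In matroid terms: adding \<open>u\<close> to the coline \<open>z(X \<circ> Y)\<close> generates the hyperplane \<open>z(X)\<close>.\<close>

definition comodular_at :: "'a svec \<Rightarrow> 'a svec \<Rightarrow> 'a \<Rightarrow> bool" where
  "comodular_at X Y u \<longleftrightarrow> X u = 0 \<and> Y u \<noteq> 0 \<and>
     (\<forall>V\<in>covectors M. V u = 0 \<and> (\<forall>h. X h = 0 \<longrightarrow> Y h = 0 \<longrightarrow> V h = 0) \<longrightarrow>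
        (\<forall>h. X h = 0 \<longrightarrow> V h = 0))"

lemma comodular_atD:
  assumes "comodular_at X Y u" "V \<in> covectors M" "V u = 0"
    "\<And>h. X h = 0 \<Longrightarrow> Y h = 0 \<Longrightarrow> V h = 0" "X h = 0"
  shows "V h = 0"
  using assms unfolding comodular_at_def by blast

text \<open>One inclusion is automatic, as \<open>zeros M X\<close> is a flat containing the coline
  and \<open>u\<close>. The other, spelled out over covectors, is the condition in
  \<open>comodular_at\<close>.\<close>

lemma closure_insert_eq_zeros_iff:
  assumes X: "X \<in> covectors M" and Y: "Y \<in> covectors M" and u: "X u = 0" "Y u \<noteq> 0"
  shows "closure M (insert u (zeros M (scomp X Y))) = zeros M X \<longleftrightarrow> comodular_at X Y u"
proof -
  have ug: "u \<in> ground M" using u covector_outside[OF Y] by blast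
  have vanish: "(\<forall>s\<in>insert u (zeros M (scomp X Y)). V s = 0) \<longleftrightarrow>
      V u = 0 \<and> (\<forall>h. X h = 0 \<longrightarrow> Y h = 0 \<longrightarrow> V h = 0)" if V: "V \<in> covectors M" for V
    using covector_outside[OF V] by (auto simp: zeros_def scomp_def)
  have "insert u (zeros M (scomp X Y)) \<subseteq> zeros M X"
    using ug u by (auto simp: zeros_def scomp_def split: if_splits)
  then have upper: "closure M (insert u (zeros M (scomp X Y))) \<subseteq> zeros M X"
    using closure_mono closure_zeros[OF X] by blast
  have "zeros M X \<subseteq> closure M (insert u (zeros M (scomp X Y))) \<longleftrightarrow>
      (\<forall>V\<in>covectors M. V u = 0 \<and> (\<forall>h. X h = 0 \<longrightarrow> Y h = 0 \<longrightarrow> V h = 0) \<longrightarrow>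
        (\<forall>h\<in>zeros M X. V h = 0))"
    using vanish by (auto simp: closure_def zeros_def)
  also have "\<dots> \<longleftrightarrow> comodular_at X Y u"
  proof -
    have "(\<forall>h\<in>zeros M X. V h = 0) \<longleftrightarrow> (\<forall>h. X h = 0 \<longrightarrow> V h = 0)" if "V \<in> covectors M" for V
      using covector_outside[OF that] by (auto simp: zeros_def)
    then show ?thesis using u by (simp add: comodular_at_def)
  qed
  finally show ?thesis using upper by blast
qed

lemma rank_closure_insert_coline:
  assumes X: "X \<in> covectors M" and Y: "Y \<in> covectors M" and u: "Y u \<noteq> 0"
  shows "rank_of M (closure M (insert u (zeros M (scomp X Y)))) =
    rank_of M (zeros M (scomp X Y)) + 1"
proof (rule rank_closure_insert)
  show "zeros M (scomp X Y) \<subseteq> ground M" by (auto simp: zeros_def)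
  show "closure M (zeros M (scomp X Y)) = zeros M (scomp X Y)"
    by (rule closure_zeros[OF covector_scomp[OF X Y]])
  show "u \<in> ground M" using u covector_outside[OF Y] by blast
  show "u \<notin> zeros M (scomp X Y)" using u by (auto simp: zeros_def scomp_def)
qed

text \<open>This replaces ranks by a condition on covectors that can be moved between oriented
  matroids. The witness concerns \<open>X\<close> only; \<open>comodular_sym\<close> supplies one
  for the exchanged pair.\<close>

lemma comodular_iff:
  "comodular M X Y \<longleftrightarrow>
     X \<in> cocircuits M \<and> Y \<in> cocircuits M \<and> (\<exists>u. comodular_at X Y u)"
proof (cases "X \<in> cocircuits M \<and> Y \<in> cocircuits M")
  case False
  then show ?thesis by (auto simp: comodular_def)
next
  case True
  then have X: "X \<in> cocircuits M" and Y: "Y \<in> cocircuits M" by auto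
  note Xc = cocircuit_covector[OF X] and Yc = cocircuit_covector[OF Y]
  let ?L = "zeros M (scomp X Y)"
  have flat: "flat M ?L"
    using closure_zeros[OF covector_scomp[OF Xc Yc]] by (auto simp: flat_def zeros_def)
  show ?thesis
  proof
    assume co: "comodular M X Y"
    \<comment> \<open>Otherwise \<open>Y\<close> vanishes wherever \<open>X\<close> does; minimality
      of \<open>X\<close> makes the zero sets equal, and then \<open>Y\<close> is \<open>X\<close>
      or \<open>- X\<close>.\<close>
    have "\<exists>u. X u = 0 \<and> Y u \<noteq> 0"
    proof (rule ccontr)
      assume none: "\<not> ?thesis"
      obtain y where y: "Y y \<noteq> 0" using Y by (auto simp: cocircuits_def supp_def)
      have "X h = 0 \<longleftrightarrow> Y h = 0" for h
      proof
        show "X h = 0 \<Longrightarrow> Y h = 0" using none by blast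
        show "X h = 0" if "Y h = 0"
        proof (rule ccontr)
          assume "X h \<noteq> 0"
          then have "Y y = 0" using cocircuit_minimal[OF X Yc _ _ that] none by blast
          with y show False by simp
        qed
      qed
      then show False using cocircuits_same_support[OF X Y] co by (auto simp: comodular_def)
    qed
    then obtain u where u: "X u = 0" "Y u \<noteq> 0" by blast
    \<comment> \<open>Both flats have rank one more than the coline, and one contains the other, so
      they coincide.\<close>
    have "rank_of M (closure M (insert u ?L)) = rank_of M (zeros M X)"
      using rank_closure_insert_coline[OF Xc Yc u(2)] rank_cocircuit_zeros[OF X] co
      by (simp add: comodular_def)
    moreover have sub: "closure M (insert u ?L) \<subseteq> zeros M X"
    proof -
      have "insert u ?L \<subseteq> zeros M X"
        using u covector_outside[OF Yc] by (auto simp: zeros_def scomp_def split: if_splits)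
      then show ?thesis using closure_mono closure_zeros[OF Xc] by blast
    qed
    moreover have "closure M (closure M (insert u ?L)) = closure M (insert u ?L)"
      using closure_minimal[OF order_refl] subset_closure[OF closure_subset_ground] by blast
    moreover have "zeros M X \<subseteq> ground M" by (auto simp: zeros_def)
    ultimately have "zeros M X \<subseteq> closure M (insert u ?L)"
      using rank_strict_mono[of "closure M (insert u ?L)" "zeros M X"] by fastforce
    with sub have "closure M (insert u ?L) = zeros M X" by blast
    then show "X \<in> cocircuits M \<and> Y \<in> cocircuits M \<and> (\<exists>u. comodular_at X Y u)"
      using closure_insert_eq_zeros_iff[OF Xc Yc u] X Y by blast
  next
    assume "X \<in> cocircuits M \<and> Y \<in> cocircuits M \<and> (\<exists>u. comodular_at X Y u)"
    then obtain u where cu: "comodular_at X Y u" by blast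
    then have u: "X u = 0" "Y u \<noteq> 0" by (auto simp: comodular_at_def)
    have "rank_of M ?L + 2 = om_rank M"
      using closure_insert_eq_zeros_iff[OF Xc Yc u] cu rank_closure_insert_coline[OF Xc Yc u(2)]
        rank_cocircuit_zeros[OF X] by simp
    moreover have "X \<noteq> Y" "X \<noteq> - Y" using u by auto
    ultimately show "comodular M X Y" using X Y flat by (simp add: comodular_def)
  qed
qed

lemma comodular_at_uminus: "comodular_at (- X) Y u \<longleftrightarrow> comodular_at X Y u"
  by (simp add: comodular_at_def)

lemma comodular_uminus: "comodular M X Y \<Longrightarrow> comodular M (- X) Y"
  by (auto simp: comodular_iff comodular_at_uminus cocircuit_uminus)

section \<open>Elimination on a coline\<close>

text \<open>Eliminating \<open>u\<close> between \<open>Z\<close> and \<open>- Z'\<close> gives a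
  covector vanishing on the coline and at \<open>u\<close>, hence on \<open>z(X)\<close>, and also
  at \<open>a\<close>; so it is zero. But it is nonzero wherever \<open>Z\<close> and
  \<open>Z'\<close> differ.\<close>

lemma coline_covector_unique:
  assumes X: "X \<in> cocircuits M" and u: "comodular_at X Y u"
    and Z: "Z \<in> covectors M" "\<And>h. X h = 0 \<Longrightarrow> Y h = 0 \<Longrightarrow> Z h = 0" "Z a = 0"
    and Z': "Z' \<in> covectors M" "\<And>h. X h = 0 \<Longrightarrow> Y h = 0 \<Longrightarrow> Z' h = 0" "Z' a = 0"
    and a: "X a \<noteq> 0" and eq: "Z u = Z' u" "Z u \<noteq> 0"
  shows "Z = Z'"
proof (rule ccontr)
  assume "Z \<noteq> Z'"
  then obtain k where k: "Z k \<noteq> Z' k" by (auto simp: fun_eq_iff)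
  have "Z u = - (- Z') u" using eq by simp
  from eliminate[OF Z(1) covector_uminus[OF Z'(1)] this eq(2)]
  obtain T where T: "T \<in> covectors M" "T u = 0"
      "\<And>h. \<not> (Z h = - (- Z') h \<and> Z h \<noteq> 0) \<Longrightarrow> T h = scomp Z (- Z') h"
    by blast
  have van: "T h = 0" if "Z h = 0" "Z' h = 0" for h
    using T(3)[of h] that by (simp add: scomp_def)
  have "T h = 0" if "X h = 0" for h
    by (rule comodular_atD[OF u T(1,2) _ that]) (use van Z(2) Z'(2) in blast)
  then have "T k = 0" by (rule cocircuit_minimal[OF X T(1) _ a]) (use van Z(3) Z'(3) in blast)+
  then show False using T(3)[of k] k by (auto simp: scomp_def split: if_splits)
qed

text \<open>For a comodular pair, any covector supplied by the elimination axiom is already a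
  cocircuit. If a nonzero \<open>V\<close> below \<open>Z\<close> missed part of its support,
  eliminating \<open>u\<close> between them would give a covector that is zero at \<open>u\<close>
  and \<open>e\<close> but not everywhere.\<close>

lemma elimination_cocircuit:
  assumes co: "comodular M X Y" and e: "X e = - Y e" "X e \<noteq> 0"
    and Z: "Z \<in> covectors M" "Z e = 0"
      "\<And>h. \<not> (X h = - Y h \<and> X h \<noteq> 0) \<Longrightarrow> Z h = scomp X Y h"
  shows "elimination M X Y e Z"
proof -
  obtain u where u: "comodular_at X Y u" using co by (auto simp: comodular_iff)
  have X: "X \<in> cocircuits M" using co by (auto simp: comodular_iff)
  have u': "X u = 0" "Y u \<noteq> 0" using u by (auto simp: comodular_at_def)
  have Zu: "Z u \<noteq> 0" using Z(3)[of u] u' by (simp add: scomp_def)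
  have van: "Z h = 0" if "X h = 0" "Y h = 0" for h
    using Z(3)[of h] that by (simp add: scomp_def)
  \<comment> \<open>The contraction by the coline has rank two, so vanishing at both
    \<open>u\<close> and \<open>e\<close> leaves only the zero covector.\<close>
  have all0: "V h = 0" if V: "V \<in> covectors M" "V u = 0" "V e = 0" "\<And>h. Z h = 0 \<Longrightarrow> V h = 0"
    for V h
    by (rule cocircuit_minimal[OF X V(1) _ e(2) V(3)], rule comodular_atD[OF u V(1,2)])
      (use van V(4) in blast)+
  have "Z \<in> cocircuits M"
  proof (rule cocircuitI[OF Z(1) Zu])
    fix V h k
    assume V: "V \<in> covectors M" "\<And>h. Z h = 0 \<Longrightarrow> V h = 0" "V h \<noteq> 0" and k: "Z k \<noteq> 0"
    show "V k \<noteq> 0"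
    proof
      assume "V k = 0"
      have Ve: "V e = 0" using V(2) Z(2) by blast
      have "V u \<noteq> 0" using all0[OF V(1) _ Ve V(2)] V(3) by blast
      from eliminate_up_to_sign[OF Z(1) V(1) Zu this]
      obtain T where T: "T \<in> covectors M" "T u = 0" "\<forall>h. Z h = 0 \<longrightarrow> V h = 0 \<longrightarrow> T h = 0"
          "\<forall>h. (Z h = 0) \<noteq> (V h = 0) \<longrightarrow> T h \<noteq> 0"
        by blast
      have "T k = 0"
        by (rule all0[OF T(1,2)]) (use T(3) Z(2) Ve V(2) in blast)+
      moreover have "T k \<noteq> 0" using T(4) k \<open>V k = 0\<close> by blast
      ultimately show False by blast
    qed
  qed
  moreover have "supp Z \<subseteq> supp (scomp X Y) - {e}"
  proof
    fix h assume "h \<in> supp Z"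
    then have "Z h \<noteq> 0" by (simp add: supp_def)
    then have "h \<noteq> e" "\<not> (X h = 0 \<and> Y h = 0)" using van Z(2) by blast+
    then show "h \<in> supp (scomp X Y) - {e}" by (auto simp: supp_def scomp_def)
  qed
  moreover have "e \<in> sep X Y" using e unfolding sep_def by blast
  moreover have "\<forall>h\<in>ground M - sep X Y. Z h = scomp X Y h"
    using Z(3) unfolding sep_def by blast
  ultimately show ?thesis using Z(2) unfolding elimination_def by blast
qed

lemma elimination_exists:
  assumes co: "comodular M X Y" and e: "X e = - Y e" "X e \<noteq> 0"
  obtains Z where "elimination M X Y e Z"
proof -
  have "X \<in> covectors M" "Y \<in> covectors M"
    using co cocircuit_covector by (auto simp: comodular_iff)
  from eliminate[OF this e] obtain Z where "Z \<in> covectors M" "Z e = 0"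
      "\<And>h. \<not> (X h = - Y h \<and> X h \<noteq> 0) \<Longrightarrow> Z h = scomp X Y h"
    by blast
  from elimination_cocircuit[OF co e this] that show thesis by blast
qed

lemma eliminationD:
  assumes el: "elimination M X Y e Z" and X: "X \<in> covectors M" and Y: "Y \<in> covectors M"
  shows "Z \<in> cocircuits M" "Z e = 0" "X e = - Y e" "X e \<noteq> 0"
    "\<And>h. \<not> (X h = - Y h \<and> X h \<noteq> 0) \<Longrightarrow> Z h = scomp X Y h"
    "\<And>h. X h = 0 \<Longrightarrow> Y h = 0 \<Longrightarrow> Z h = 0"
proof -
  show Z: "Z \<in> cocircuits M" "Z e = 0" using el by (auto simp: elimination_def)
  have "e \<in> sep X Y" using el by (auto simp: elimination_def)
  then show "X e = - Y e" "X e \<noteq> 0" unfolding sep_def by blast+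
  show agree: "Z h = scomp X Y h" if "\<not> (X h = - Y h \<and> X h \<noteq> 0)" for h
  proof (cases "h \<in> ground M")
    case True
    then show ?thesis using el that unfolding elimination_def sep_def by blast
  next
    case False
    then have "X h = 0" "Y h = 0" "Z h = 0"
      using covector_outside X Y cocircuit_covector[OF Z(1)] by blast+
    then show ?thesis by (simp add: scomp_def)
  qed
  show "Z h = 0" if "X h = 0" "Y h = 0" for h
    using agree[of h] that by (simp add: scomp_def)
qed

text \<open>The element \<open>u\<close> is not separated, so both eliminations carry the nonzero
  sign \<open>Y u\<close> there.\<close>

lemma elimination_unique:
  assumes co: "comodular M X Y" and Z: "elimination M X Y e Z" and Z': "elimination M X Y e Z'"
  shows "Z = Z'"
proof -
  obtain u where u: "comodular_at X Y u" using co by (auto simp: comodular_iff)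
  have XY: "X \<in> cocircuits M" "Y \<in> cocircuits M" using co by (auto simp: comodular_iff)
  note c = cocircuit_covector[OF XY(1)] cocircuit_covector[OF XY(2)]
  note D = eliminationD[OF Z c] and D' = eliminationD[OF Z' c]
  have u': "X u = 0" "Y u \<noteq> 0" using u by (auto simp: comodular_at_def)
  have eq: "Z u = Y u" "Z' u = Y u" using D(5)[of u] D'(5)[of u] u' by (auto simp: scomp_def)
  show ?thesis
    by (rule coline_covector_unique[OF XY(1) u cocircuit_covector[OF D(1)] D(6) D(2)
          cocircuit_covector[OF D'(1)] D'(6) D'(2) D(4)])
      (use eq u' in auto)
qed

end

subsection \<open>Directed walks\<close>

text \<open>Edges are collected into relations so that walks become reflexive transitive
  closures.\<close>

definition weak_edges :: "'a orimat \<Rightarrow> 'a \<Rightarrow> 'a \<Rightarrow> ('a svec \<times> 'a svec) set" where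
  "weak_edges M g f = {(X, Y). Gf_edge M g X Y \<and>
     (orientation M g f X Y 1 \<or> orientation M g f X Y 0)}"

definition strict_edges :: "'a orimat \<Rightarrow> 'a \<Rightarrow> 'a \<Rightarrow> ('a svec \<times> 'a svec) set" where
  "strict_edges M g f = {(X, Y). Gf_edge M g X Y \<and> orientation M g f X Y 1}"

text \<open>In a walk of least length, a repeated vertex would allow a shortcut.\<close>

lemma shortest_path:
  assumes "(a, b) \<in> R\<^sup>*"
  obtains p n where "p 0 = a" "p n = b" "\<forall>i<n. (p i, p (Suc i)) \<in> R" "inj_on p {..n}"
proof -
  define n where "n = (LEAST n. (a, b) \<in> R ^^ n)"
  have n: "(a, b) \<in> R ^^ n"
    unfolding n_def using assms by (metis LeastI rtrancl_imp_relpow)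
  have least: "n \<le> m" if "(a, b) \<in> R ^^ m" for m
    unfolding n_def using that by (rule Least_le)
  obtain p where p: "p 0 = a" "p n = b" "\<forall>i<n. (p i, p (Suc i)) \<in> R"
    using n by (auto simp: relpow_fun_conv)
  have False if ij: "i < j" "j \<le> n" "p i = p j" for i j
  proof -
    have "(a, p i) \<in> R ^^ i" unfolding relpow_fun_conv using p ij by (intro exI[of _ p]) auto
    moreover have "(p j, b) \<in> R ^^ (n - j)"
      unfolding relpow_fun_conv using p ij by (intro exI[of _ "\<lambda>k. p (j + k)"]) auto
    ultimately have "(a, b) \<in> R ^^ (i + (n - j))" using ij(3) by (auto simp: relpow_add)
    then show False using least ij by fastforce
  qed
  then have "inj_on p {..n}" by (intro inj_onI) (metis atMost_iff linorder_neqE_nat)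
  with p that show thesis by blast
qed

text \<open>Cycles may be replaced by closed walks through a directed edge: only the return walk is
  shortened to a simple path, so the directed edge survives.\<close>

lemma directed_cycle_iff:
  "(\<exists>P n. directed_cycle M g f P n) \<longleftrightarrow>
     (\<exists>X Y. (X, Y) \<in> strict_edges M g f \<and> (Y, X) \<in> (weak_edges M g f)\<^sup>*)"
proof
  assume "\<exists>P n. directed_cycle M g f P n"
  then obtain P n where "directed_cycle M g f P n" by blast
  then have P: "P n = P 0" "\<forall>i<n. (P i, P (Suc i)) \<in> weak_edges M g f"
      "\<exists>i<n. (P i, P (Suc i)) \<in> strict_edges M g f"
    by (auto simp: directed_cycle_def weak_edges_def strict_edges_def)
  then obtain i where i: "i < n" "(P i, P (Suc i)) \<in> strict_edges M g f" by blast
  have path: "(P j, P k) \<in> (weak_edges M g f)\<^sup>*" if "j \<le> k" "k \<le> n" for j k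
    using that
  proof (induction k rule: dec_induct)
    case (step k)
    then show ?case using P(2) by (meson Suc_le_lessD Suc_leD rtrancl.rtrancl_into_rtrancl)
  qed simp
  have "(P (Suc i), P i) \<in> (weak_edges M g f)\<^sup>*"
    using path[of "Suc i" n] path[of 0 i] i(1) P(1) by (simp add: rtrancl_trans)
  with i(2) show "\<exists>X Y. (X, Y) \<in> strict_edges M g f \<and> (Y, X) \<in> (weak_edges M g f)\<^sup>*" by blast
next
  assume "\<exists>X Y. (X, Y) \<in> strict_edges M g f \<and> (Y, X) \<in> (weak_edges M g f)\<^sup>*"
  then obtain X Y where XY: "(X, Y) \<in> strict_edges M g f" "(Y, X) \<in> (weak_edges M g f)\<^sup>*" by blast
  obtain p n where p: "p 0 = Y" "p n = X" "\<forall>i<n. (p i, p (Suc i)) \<in> weak_edges M g f"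
      "inj_on p {..n}"
    using shortest_path[OF XY(2)] by blast
  define P where "P i = (case i of 0 \<Rightarrow> X | Suc j \<Rightarrow> p j)" for i
  have edge: "(P i, P (Suc i)) \<in> weak_edges M g f" if "i < Suc n" for i
    using that XY(1) p by (cases i) (auto simp: P_def weak_edges_def strict_edges_def)
  have "inj_on P {..<Suc n}"
  proof (rule inj_onI)
    fix i j assume ij: "i \<in> {..<Suc n}" "j \<in> {..<Suc n}" "P i = P j"
    \<comment> \<open>Index \<open>0\<close> is sent to \<open>n\<close> because
      \<open>P 0 = X = p n\<close>; this reduces injectivity of \<open>P\<close> to that of
      \<open>p\<close>.\<close>
    define c where "c i = (case i of 0 \<Rightarrow> n | Suc j \<Rightarrow> j)" for i
    have "P i = p (c i)" "P j = p (c j)" "c i \<le> n" "c j \<le> n"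
      using ij p(2) by (auto simp: P_def c_def split: nat.splits)
    then have "c i = c j" using ij(3) p(4) by (simp add: inj_on_eq_iff)
    then show "i = j" using ij(1,2) by (auto simp: c_def split: nat.splits)
  qed
  moreover have "P (Suc n) = P 0" using p(2) by (simp add: P_def)
  moreover have "\<exists>i<Suc n. orientation M g f (P i) (P (Suc i)) 1"
    by (rule exI[of _ 0]) (use XY(1) p(1) in \<open>auto simp: P_def strict_edges_def\<close>)
  ultimately have "directed_cycle M g f P (Suc n)"
    using edge by (auto simp: directed_cycle_def weak_edges_def)
  then show "\<exists>P n. directed_cycle M g f P n" by blast
qed

context oriented_mat
begin

text \<open>A cocircuit eliminating a separating element lies between the two given ones on their
  coline, where the orientation is constant.\<close>

lemma orientation_between:
  assumes ori: "orientation M g f X Y s" and el: "elimination M X Y h Q"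
  shows "orientation M g f X Q s" "orientation M g f Q Y s"
proof -
  have co: "comodular M X Y" and g: "X g = Y g" "X g \<noteq> 0" using ori by (auto simp: orientation_def)
  obtain Z where Z: "elimination M (- X) Y g Z" "Z f = s" using ori by (auto simp: orientation_def)
  have X: "X \<in> cocircuits M" and Y: "Y \<in> cocircuits M" using co by (auto simp: comodular_iff)
  note Xc = cocircuit_covector[OF X] and Yc = cocircuit_covector[OF Y]
  note Q = eliminationD[OF el Xc Yc]
  note Qc = cocircuit_covector[OF Q(1)]
  note D = eliminationD[OF Z(1) covector_uminus[OF Xc] Yc]
  obtain u where u: "comodular_at X Y u" using co by (auto simp: comodular_iff)
  obtain v where v: "comodular_at Y X v" using comodular_sym[OF co] by (auto simp: comodular_iff)
  have u': "X u = 0" "Y u \<noteq> 0" and v': "Y v = 0" "X v \<noteq> 0"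
    using u v unfolding comodular_at_def by blast+
  have Qg: "Q g = X g" using Q(5)[of g] g by (simp add: scomp_def)
  have Qu: "Q u = Y u" and Qv: "Q v = X v" using Q(5)[of u] Q(5)[of v] u' v' by (auto simp: scomp_def)
  \<comment> \<open>The witness \<open>u\<close> still works: \<open>Q\<close> vanishes on the
    coline, so the common zeros of \<open>X\<close> and \<open>Q\<close> contain it, and
    \<open>Q u = Y u\<close> is nonzero.\<close>
  have "comodular_at X Q u"
    unfolding comodular_at_def
  proof (intro conjI ballI impI allI)
    fix V k assume V: "V \<in> covectors M" "V u = 0 \<and> (\<forall>h. X h = 0 \<longrightarrow> Q h = 0 \<longrightarrow> V h = 0)" "X k = 0"
    show "V k = 0" by (rule comodular_atD[OF u V(1) _ _ V(3)]) (use V(2) Q(6) in blast)+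
  qed (use u' Qu in auto)
  then have coXQ: "comodular M X Q" using X Q(1) by (auto simp: comodular_iff)
  have "comodular_at Y Q v"
    unfolding comodular_at_def
  proof (intro conjI ballI impI allI)
    fix V k assume V: "V \<in> covectors M" "V v = 0 \<and> (\<forall>h. Y h = 0 \<longrightarrow> Q h = 0 \<longrightarrow> V h = 0)" "Y k = 0"
    show "V k = 0" by (rule comodular_atD[OF v V(1) _ _ V(3)]) (use V(2) Q(6) in blast)+
  qed (use v' Qv in auto)
  then have "comodular M Y Q" using Y Q(1) by (auto simp: comodular_iff)
  then have coQY: "comodular M Q Y" by (rule comodular_sym)
  obtain Z1 where Z1: "elimination M (- X) Q g Z1"
    using elimination_exists[OF comodular_uminus[OF coXQ], of g] Qg g by auto
  note D1 = eliminationD[OF Z1 covector_uminus[OF Xc] Qc]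
  \<comment> \<open>Both vanish on the coline and at \<open>g\<close> and have the sign
    \<open>Y u\<close> at \<open>u\<close>. The second half argues in the same way with
    \<open>v\<close>, where the common sign is \<open>- X v\<close>.\<close>
  have "Z1 = Z"
  proof (rule coline_covector_unique[OF X u cocircuit_covector[OF D1(1)] _ D1(2)
        cocircuit_covector[OF D(1)] _ D(2) g(2)])
    show "Z1 u = Z u" "Z1 u \<noteq> 0" using D1(5)[of u] D(5)[of u] u' Qu by (auto simp: scomp_def)
  qed (use D(6) D1(6) Q(6) in auto)
  then show "orientation M g f X Q s"
    using coXQ Qg g Z1 Z(2) by (auto simp: orientation_def)
  obtain Z2 where Z2: "elimination M (- Q) Y g Z2"
    using elimination_exists[OF comodular_uminus[OF coQY], of g] Qg g by auto
  note D2 = eliminationD[OF Z2 covector_uminus[OF Qc] Yc]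
  have "Z2 = Z"
  proof (rule coline_covector_unique[OF Y v cocircuit_covector[OF D2(1)] _ D2(2)
        cocircuit_covector[OF D(1)] _ D(2)])
    show "Y g \<noteq> 0" using g by simp
    show "Z2 v = Z v" "Z2 v \<noteq> 0" using D2(5)[of v] D(5)[of v] v' Qv by (auto simp: scomp_def)
  qed (use D(6) D2(6) Q(6) in auto)
  then show "orientation M g f Q Y s"
    using coQY Qg g Z2 Z(2) by (auto simp: orientation_def)
qed

text \<open>Induction on the number of separating elements: eliminating one inserts a cocircuit
  \<open>Q\<close> between \<open>X\<close> and \<open>Y\<close>, and both halves keep the sign
  \<open>s\<close>. A directed edge is only needed from the first half.\<close>

lemma orientation_walk:
  assumes "orientation M g f X Y s" "s = 0 \<or> s = 1" "X g = 1"
  shows "(X, Y) \<in> (weak_edges M g f)\<^sup>* \<and>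
    (s = 1 \<longrightarrow> (X, Y) \<in> (weak_edges M g f)\<^sup>* O strict_edges M g f O (weak_edges M g f)\<^sup>*)"
  using assms(1,3)
proof (induction "card (sep X Y)" arbitrary: X Y rule: less_induct)
  case less
  note ori = less.prems(1)
  have co: "comodular M X Y" and g: "Y g = 1"
    using ori less.prems(2) by (auto simp: orientation_def)
  have X: "X \<in> cocircuits M" and Y: "Y \<in> cocircuits M" using co by (auto simp: comodular_iff)
  note Xc = cocircuit_covector[OF X] and Yc = cocircuit_covector[OF Y]
  show ?case
  proof (cases "sep X Y = {}")
    case True
    then have "Gf_edge M g X Y"
      using co X Y g less.prems(2) by (simp add: Gf_edge_def Gf_vertices_def conformal_def)
    then have "(X, Y) \<in> weak_edges M g f" "s = 1 \<Longrightarrow> (X, Y) \<in> strict_edges M g f"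
      using ori assms(2) by (auto simp: weak_edges_def strict_edges_def)
    then show ?thesis by blast
  next
    case False
    then obtain h where h: "X h = - Y h" "X h \<noteq> 0" by (auto simp: sep_def)
    obtain Q where Q: "elimination M X Y h Q" using elimination_exists[OF co h] by blast
    note D = eliminationD[OF Q Xc Yc]
    note between = orientation_between[OF ori Q]
    have fin: "finite (sep X Y)"
      by (rule finite_subset[OF _ finite_ground])
        (use covector_outside[OF Xc] in \<open>auto simp: sep_def\<close>)
    have hs: "h \<in> sep X Y" using h unfolding sep_def by blast
    have agree: "Q k = (if X k \<noteq> 0 then X k else Y k)" if "k \<notin> sep X Y" for k
      using D(5)[of k] that by (simp add: sep_def scomp_def)
    \<comment> \<open>Off \<open>sep X Y\<close>, the entries of \<open>Q\<close> are those of the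
      composition, so no new separation arises, while \<open>h\<close> is removed because
      \<open>Q h = 0\<close>.\<close>
    have "sep X Q \<subset> sep X Y"
    proof (rule psubsetI)
      show "sep X Q \<subseteq> sep X Y"
      proof
        fix k assume k: "k \<in> sep X Q"
        show "k \<in> sep X Y"
        proof (rule ccontr)
          assume "k \<notin> sep X Y"
          from agree[OF this] k show False by (auto simp: sep_def)
        qed
      qed
      have "h \<notin> sep X Q" using D(2) h(2) by (simp add: sep_def)
      then show "sep X Q \<noteq> sep X Y" using hs by blast
    qed
    then have "card (sep X Q) < card (sep X Y)" by (rule psubset_card_mono[OF fin])
    from less.hyps[OF this between(1) less.prems(2)]
    have XQ: "(X, Q) \<in> (weak_edges M g f)\<^sup>*"
      "s = 1 \<Longrightarrow> (X, Q) \<in> (weak_edges M g f)\<^sup>* O strict_edges M g f O (weak_edges M g f)\<^sup>*"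
      by blast+
    have "sep Q Y \<subset> sep X Y"
    proof (rule psubsetI)
      show "sep Q Y \<subseteq> sep X Y"
      proof
        fix k assume k: "k \<in> sep Q Y"
        show "k \<in> sep X Y"
        proof (rule ccontr)
          assume nk: "k \<notin> sep X Y"
          from agree[OF nk] k nk show False by (auto simp: sep_def split: if_splits)
        qed
      qed
      have "h \<notin> sep Q Y" using D(2) by (simp add: sep_def)
      then show "sep Q Y \<noteq> sep X Y" using hs by blast
    qed
    then have "card (sep Q Y) < card (sep X Y)" by (rule psubset_card_mono[OF fin])
    moreover have "Q g = 1" using between(1) less.prems(2) by (auto simp: orientation_def)
    ultimately have QY: "(Q, Y) \<in> (weak_edges M g f)\<^sup>*"
      using less.hyps[OF _ between(2)] by blast
    have "(X, Y) \<in> (weak_edges M g f)\<^sup>*" using XQ(1) QY by (rule rtrancl_trans)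
    moreover have "(X, Y) \<in> (weak_edges M g f)\<^sup>* O strict_edges M g f O (weak_edges M g f)\<^sup>*"
      if "s = 1"
      using XQ(2)[OF that] QY by (meson relcomp.simps rtrancl_trans)
    ultimately show ?thesis by blast
  qed
qed

end

subsection \<open>Minors of full rank\<close>

text \<open>The assumptions say that, up to the relabelling \<open>\<phi>\<close>, the restriction of \<open>P\<close> to \<open>H\<close> is the
  restriction to \<open>\<phi> ` H\<close> of the contraction of \<open>M\<close> by \<open>G\<close>, and that \<open>\<phi> ` H\<close> spans that
  contraction.\<close>

locale spanning_minor = M: oriented_mat M + P: oriented_mat P
  for M :: "'a orimat" and P :: "'b orimat" +
  fixes \<phi> :: "'b \<Rightarrow> 'a" and G :: "'a set" and H :: "'b set"
  assumes H_ground: "H \<subseteq> ground P"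
    and \<phi>_ground: "\<phi> ` H \<subseteq> ground M - G"
    and inj_\<phi>: "inj_on \<phi> H"
    and pull: "\<lbrakk>V \<in> covectors M; \<forall>g\<in>G. V g = 0\<rbrakk> \<Longrightarrow>
      (\<lambda>x. if x \<in> H then V (\<phi> x) else 0) \<in> covectors P"
    and lift: "W \<in> covectors P \<Longrightarrow>
      \<exists>V\<in>covectors M. (\<forall>g\<in>G. V g = 0) \<and> (\<forall>x\<in>H. V (\<phi> x) = W x)"
    and spanning: "\<lbrakk>V \<in> covectors M; \<forall>g\<in>G. V g = 0; \<forall>x\<in>H. V (\<phi> x) = 0\<rbrakk> \<Longrightarrow> V e = 0"
begin

abbreviation pullback :: "'a svec \<Rightarrow> 'b svec" where
  "pullback V \<equiv> (\<lambda>x. if x \<in> H then V (\<phi> x) else 0)"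

text \<open>Minimality in \<open>P\<close> makes the pullback of \<open>U\<close> zero, and
  \<open>spanning\<close> carries this back to \<open>U\<close>.\<close>

lemma pullback_vanishes_below_cocircuit:
  assumes W: "pullback V \<in> cocircuits P" and U: "U \<in> covectors M" "\<forall>g\<in>G. U g = 0"
    and sub: "\<And>x. x \<in> H \<Longrightarrow> V (\<phi> x) = 0 \<Longrightarrow> U (\<phi> x) = 0"
    and x: "x \<in> H" "V (\<phi> x) \<noteq> 0" "U (\<phi> x) = 0"
  shows "U e = 0"
proof (rule spanning[OF U])
  have "pullback U y = 0" for y
    by (rule P.cocircuit_minimal[OF W pull[OF U], of x]) (use x sub in auto)
  then show "\<forall>y\<in>H. U (\<phi> y) = 0" by metis
qed

text \<open>\<open>U\<close> and \<open>V\<close> share a nonzero entry on the image of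
  \<open>H\<close>. Eliminating it gives a covector that is zero by the previous lemma, although it
  is nonzero wherever the supports differ.\<close>

lemma lift_below_cocircuit:
  assumes V: "V \<in> covectors M" "\<forall>g\<in>G. V g = 0" and W: "pullback V \<in> cocircuits P"
    and U: "U \<in> covectors M" "\<forall>g\<in>G. U g = 0" "U h \<noteq> 0"
    and sub: "\<And>x. x \<in> H \<Longrightarrow> V (\<phi> x) = 0 \<Longrightarrow> U (\<phi> x) = 0"
  shows "(U k = 0) = (V k = 0)"
proof (rule ccontr)
  assume k: "\<not> ?thesis"
  obtain x where x: "x \<in> H" "U (\<phi> x) \<noteq> 0" using spanning[OF U(1,2)] U(3) by blast
  then have Vx: "V (\<phi> x) \<noteq> 0" using sub by blast
  obtain T where T: "T \<in> covectors M" "T (\<phi> x) = 0" "\<forall>h. U h = 0 \<longrightarrow> V h = 0 \<longrightarrow> T h = 0"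
      "\<forall>h. (U h = 0) \<noteq> (V h = 0) \<longrightarrow> T h \<noteq> 0"
    using M.eliminate_up_to_sign[OF U(1) V(1) x(2) Vx] by blast
  have "T k = 0"
    by (rule pullback_vanishes_below_cocircuit[OF W T(1) _ _ x(1) Vx T(2)])
      (use T(3) U(2) V(2) sub in blast)+
  moreover have "T k \<noteq> 0" using T(4) k by blast
  ultimately show False by blast
qed

lemma lift_cocircuit:
  assumes V: "V \<in> covectors M" "\<forall>g\<in>G. V g = 0" and W: "pullback V \<in> cocircuits P"
  shows "V \<in> cocircuits M"
proof -
  obtain y where "pullback V y \<noteq> 0" using W by (auto simp: cocircuits_def supp_def)
  then have "V (\<phi> y) \<noteq> 0" by (metis (full_types))
  then show ?thesis
  proof (rule M.cocircuitI[OF V(1)])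
    fix U h k assume U: "U \<in> covectors M" "\<And>h. V h = 0 \<Longrightarrow> U h = 0" "U h \<noteq> 0" "V k \<noteq> 0"
    have "\<forall>g\<in>G. U g = 0" using U(2) V(2) by blast
    then show "U k \<noteq> 0" using lift_below_cocircuit[OF V W U(1) _ U(3)] U(2,4) by blast
  qed
qed

text \<open>If \<open>u\<close> is a witness for the pullbacks, then \<open>\<phi> u\<close> is one
  for the lifts: the condition in \<open>P\<close> puts the pullback of \<open>U\<close> below that
  of \<open>V\<close>, and \<open>lift_below_cocircuit\<close> concludes.\<close>

lemma lift_comodular:
  assumes V: "V \<in> covectors M" "\<forall>g\<in>G. V g = 0" and V': "V' \<in> covectors M" "\<forall>g\<in>G. V' g = 0"
    and co: "comodular P (pullback V) (pullback V')"
  shows "comodular M V V'"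
proof -
  have W: "pullback V \<in> cocircuits P" "pullback V' \<in> cocircuits P"
    using co by (auto simp: P.comodular_iff)
  obtain u where u: "P.comodular_at (pullback V) (pullback V') u"
    using co by (auto simp: P.comodular_iff)
  have u0: "pullback V u = 0" "pullback V' u \<noteq> 0" using u unfolding P.comodular_at_def by blast+
  then have u': "u \<in> H" "V (\<phi> u) = 0" "V' (\<phi> u) \<noteq> 0" by (auto split: if_splits)
  have "M.comodular_at V V' (\<phi> u)"
    unfolding M.comodular_at_def
  proof (intro conjI ballI impI allI)
    fix U k
    assume U: "U \<in> covectors M"
      "U (\<phi> u) = 0 \<and> (\<forall>h. V h = 0 \<longrightarrow> V' h = 0 \<longrightarrow> U h = 0)" and k: "V k = 0"
    have UG: "\<forall>g\<in>G. U g = 0" using U(2) V(2) V'(2) by blast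
    have "pullback U y = 0" if "pullback V y = 0" for y
      by (rule P.comodular_atD[OF u pull[OF U(1) UG] _ _ that])
        (use U(2) in \<open>auto split: if_splits\<close>)
    then have "U (\<phi> x) = 0" if "x \<in> H" "V (\<phi> x) = 0" for x
      using that by (metis (full_types))
    then show "U k = 0" using lift_below_cocircuit[OF V W(1) U(1) UG, of k k] k by blast
  qed (use u' in auto)
  then show ?thesis
    using lift_cocircuit[OF V W(1)] lift_cocircuit[OF V' W(2)] by (auto simp: M.comodular_iff)
qed

text \<open>The elimination in \<open>M\<close> pulls back to one in \<open>P\<close>. Uniqueness
  there identifies it with the given one, so the signs at \<open>\<phi> b\<close> and
  \<open>b\<close> agree.\<close>

lemma lift_orientation:
  assumes V: "V \<in> covectors M" "\<forall>g\<in>G. V g = 0" and V': "V' \<in> covectors M" "\<forall>g\<in>G. V' g = 0"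
    and H: "a \<in> H" "b \<in> H" and ori: "orientation P a b (pullback V) (pullback V') s"
  shows "orientation M (\<phi> a) (\<phi> b) V V' s"
proof -
  have coP: "comodular P (pullback V) (pullback V')"
    and a: "V (\<phi> a) = V' (\<phi> a)" "V (\<phi> a) \<noteq> 0"
    using ori H by (auto simp: orientation_def)
  obtain Z0 where Z0: "elimination P (- pullback V) (pullback V') a Z0" "Z0 b = s"
    using ori by (auto simp: orientation_def)
  have co: "comodular M V V'" by (rule lift_comodular[OF V V' coP])
  obtain Z where Z: "elimination M (- V) V' (\<phi> a) Z"
    using M.elimination_exists[OF M.comodular_uminus[OF co], of "\<phi> a"] a by auto
  note D = M.eliminationD[OF Z M.covector_uminus[OF V(1)] V'(1)]
  have ZG: "\<forall>g\<in>G. Z g = 0" using D(6) V(2) V'(2) by simp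
  have "elimination P (- pullback V) (pullback V') a (pullback Z)"
  proof (rule P.elimination_cocircuit[OF P.comodular_uminus[OF coP]])
    show "pullback Z \<in> covectors P" by (rule pull[OF M.cocircuit_covector[OF D(1)] ZG])
    show "pullback Z h = scomp (- pullback V) (pullback V') h"
      if "\<not> ((- pullback V) h = - pullback V' h \<and> (- pullback V) h \<noteq> 0)" for h
      using that D(5)[of "\<phi> h"] by (auto simp: scomp_def)
  qed (use a H D(2) in auto)
  then have "pullback Z = Z0"
    using P.elimination_unique[OF P.comodular_uminus[OF coP] _ Z0(1)] by blast
  then have "Z (\<phi> b) = s" using H(2) Z0(2) by auto
  then show ?thesis using co a Z by (auto simp: orientation_def)
qed

text \<open>The support condition makes each vertex the pullback of its lift. Edges then lift to
  walks, which together form a closed walk with a directed edge.\<close>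

lemma lift_directed_cycle:
  assumes H: "a \<in> H" "b \<in> H"
    and supp: "\<And>W x. W \<in> cocircuits P \<Longrightarrow> W a = 1 \<Longrightarrow> x \<notin> H \<Longrightarrow> W x = 0"
    and cycle: "\<exists>p n. directed_cycle P a b p n"
  shows "\<exists>p n. directed_cycle M (\<phi> a) (\<phi> b) p n"
proof -
  define R where "R = weak_edges M (\<phi> a) (\<phi> b)"
  define S where "S = strict_edges M (\<phi> a) (\<phi> b)"
  \<comment> \<open>One lift is fixed for each vertex, so that the walks of consecutive edges fit
    together.\<close>
  define up where "up W = (SOME V. V \<in> covectors M \<and> (\<forall>g\<in>G. V g = 0) \<and> pullback V = W)" for W
  have up: "up W \<in> covectors M" "\<forall>g\<in>G. up W g = 0" "pullback (up W) = W"
    if W: "W \<in> Gf_vertices P a" for W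
  proof -
    have W': "W \<in> cocircuits P" "W a = 1" using W by (auto simp: Gf_vertices_def)
    obtain V where V: "V \<in> covectors M" "\<forall>g\<in>G. V g = 0" "\<forall>x\<in>H. V (\<phi> x) = W x"
      using lift[OF P.cocircuit_covector[OF W'(1)]] by blast
    have "pullback V = W" using V(3) supp[OF W'] by auto
    with V have "\<exists>V. V \<in> covectors M \<and> (\<forall>g\<in>G. V g = 0) \<and> pullback V = W" by blast
    from someI_ex[OF this]
    show "up W \<in> covectors M" "\<forall>g\<in>G. up W g = 0" "pullback (up W) = W"
      unfolding up_def by blast+
  qed
  have walk: "(up W, up W') \<in> R\<^sup>* \<and> (s = 1 \<longrightarrow> (up W, up W') \<in> R\<^sup>* O S O R\<^sup>*)"
    if e: "Gf_edge P a W W'" and o: "orientation P a b W W' s" "s = 0 \<or> s = 1" for W W' s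
  proof -
    have W: "W \<in> Gf_vertices P a" "W' \<in> Gf_vertices P a" using e by (auto simp: Gf_edge_def)
    have "up W (\<phi> a) = 1"
      using fun_cong[OF up(3)[OF W(1)], of a] W(1) H(1) by (simp add: Gf_vertices_def)
    moreover have "orientation M (\<phi> a) (\<phi> b) (up W) (up W') s"
      by (rule lift_orientation[OF up(1,2)[OF W(1)] up(1,2)[OF W(2)] H])
        (simp only: up(3)[OF W(1)] up(3)[OF W(2)] o(1))
    ultimately show ?thesis
      unfolding R_def S_def using M.orientation_walk o(2) by blast
  qed
  obtain X Y where XY: "(X, Y) \<in> strict_edges P a b" "(Y, X) \<in> (weak_edges P a b)\<^sup>*"
    using cycle unfolding directed_cycle_iff by blast
  have "(up Y, up X) \<in> R\<^sup>*"
    using XY(2)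
  proof (induction rule: rtrancl_induct)
    case (step W W')
    then have "(up W, up W') \<in> R\<^sup>*" using walk by (auto simp: weak_edges_def)
    with step.IH show ?case by (rule rtrancl_trans)
  qed simp
  moreover have "(up X, up Y) \<in> R\<^sup>* O S O R\<^sup>*" using walk XY(1) by (auto simp: strict_edges_def)
  \<comment> \<open>The closed walk is rotated so as to start at a directed edge of
    \<open>M\<close>.\<close>
  then obtain A B where "(up X, A) \<in> R\<^sup>*" "(A, B) \<in> S" "(B, up Y) \<in> R\<^sup>*" by blast
  ultimately have "(A, B) \<in> S" "(B, A) \<in> R\<^sup>*" by (meson rtrancl_trans)+
  then show ?thesis unfolding directed_cycle_iff R_def S_def by blast
qed

text \<open>A nonzero entry at \<open>a\<close> lifts. A covector supported at
  \<open>\<phi> b\<close> alone vanishes on \<open>G\<close> and pulls back to one supported at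
  \<open>b\<close> alone.\<close>

lemma lift_program:
  assumes H: "a \<in> H" "b \<in> H" and prog: "om_program P a b"
  shows "om_program M (\<phi> a) (\<phi> b)"
proof -
  have "\<phi> a \<noteq> \<phi> b" using inj_\<phi> H prog by (auto simp: om_program_def inj_on_eq_iff)
  moreover have "\<not> loop M (\<phi> a)"
  proof -
    obtain W where W: "W \<in> covectors P" "W a \<noteq> 0"
      using prog by (auto simp: om_program_def loop_def closure_def)
    obtain V where "V \<in> covectors M" "\<forall>x\<in>H. V (\<phi> x) = W x" using lift[OF W(1)] by blast
    then have "V \<in> covectors M" "V (\<phi> a) \<noteq> 0" using W(2) H(1) by auto
    then show ?thesis by (auto simp: loop_def closure_def)
  qed
  moreover have "\<not> coloop M (\<phi> b)"
  proof
    assume "coloop M (\<phi> b)"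
    then obtain V where V: "V \<in> covectors M" "\<forall>s\<in>ground M - {\<phi> b}. V s = 0" "V (\<phi> b) \<noteq> 0"
      by (auto simp: coloop_def closure_def)
    have bG: "\<phi> b \<notin> G" using \<phi>_ground H(2) by blast
    have "\<forall>g\<in>G. V g = 0"
    proof
      fix g assume "g \<in> G"
      then have "g \<noteq> \<phi> b" using bG by blast
      then show "V g = 0" using V(2) M.covector_outside[OF V(1), of g] by blast
    qed
    define W where "W = pullback V"
    have W: "W \<in> covectors P" unfolding W_def by (rule pull[OF V(1) \<open>\<forall>g\<in>G. V g = 0\<close>])
    have "V (\<phi> x) = 0" if "x \<in> H" "x \<noteq> b" for x
      using that H(2) V(2) \<phi>_ground inj_\<phi> by (auto simp: inj_on_eq_iff)
    then have "\<forall>s\<in>ground P - {b}. W s = 0" by (auto simp: W_def)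
    moreover have "W b \<noteq> 0" using H(2) V(3) by (simp add: W_def)
    ultimately have "b \<notin> closure P (ground P - {b})" using W unfolding closure_def by blast
    then show False using prog by (auto simp: om_program_def coloop_def)
  qed
  ultimately show ?thesis using M.om H \<phi>_ground by (auto simp: om_program_def)
qed

end

subsection \<open>Deletions and parallel extensions\<close>

lemma deletion_deletion: "deletion (deletion M A) B = deletion M (A \<union> B)"
proof -
  have "srestrict (ground M - A - B) (srestrict (ground M - A) X) = srestrict (ground M - (A \<union> B)) X"
    for X :: "'a svec" by (auto simp: srestrict_def)
  then show ?thesis by (simp add: deletion_def image_image Diff_eq Int_assoc)
qed

lemma oriented_matroid_deletion:
  assumes "oriented_matroid M"
  shows "oriented_matroid (deletion M A)"
proof -
  interpret oriented_mat M by unfold_locales fact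
  let ?S = "ground M - A"
  show ?thesis
    unfolding oriented_matroid_def
  proof (intro conjI ballI)
    show "finite (ground (deletion M A))" using finite_ground by (simp add: deletion_def)
    show "covectors (deletion M A) \<subseteq> sign_vectors (ground (deletion M A))"
      using covector_sign by (fastforce simp: deletion_def sign_vectors_def srestrict_def)
    show "(\<lambda>_. 0) \<in> covectors (deletion M A)"
      using covector_zero by (force simp: deletion_def srestrict_def image_iff)
  next
    fix X assume "X \<in> covectors (deletion M A)"
    then obtain X0 where X0: "X0 \<in> covectors M" "X = srestrict ?S X0" by (auto simp: deletion_def)
    have "- X = srestrict ?S (- X0)" using X0 by (auto simp: srestrict_def)
    then show "- X \<in> covectors (deletion M A)"
      using covector_uminus[OF X0(1)] by (simp add: deletion_def)
    fix Y assume "Y \<in> covectors (deletion M A)"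
    then obtain Y0 where Y0: "Y0 \<in> covectors M" "Y = srestrict ?S Y0" by (auto simp: deletion_def)
    have "scomp X Y = srestrict ?S (scomp X0 Y0)"
      using X0 Y0 by (auto simp: srestrict_def scomp_def)
    then show "scomp X Y \<in> covectors (deletion M A)"
      using covector_scomp[OF X0(1) Y0(1)] by (simp add: deletion_def)
    fix e assume "e \<in> sep X Y"
    then have e: "X0 e = - Y0 e" "X0 e \<noteq> 0"
      using X0(2) Y0(2) by (auto simp: sep_def srestrict_def split: if_splits)
    obtain Z where Z: "Z \<in> covectors M" "Z e = 0"
        "\<And>h. \<not> (X0 h = - Y0 h \<and> X0 h \<noteq> 0) \<Longrightarrow> Z h = scomp X0 Y0 h"
      using eliminate[OF X0(1) Y0(1) e] by blast
    show "\<exists>Z\<in>covectors (deletion M A). Z e = 0 \<and>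
        (\<forall>h\<in>ground (deletion M A) - sep X Y. Z h = scomp X Y h)"
    proof (intro bexI conjI ballI)
      show "srestrict ?S Z \<in> covectors (deletion M A)" using Z(1) by (simp add: deletion_def)
      show "srestrict ?S Z e = 0" using Z(2) by (simp add: srestrict_def)
      fix h assume "h \<in> ground (deletion M A) - sep X Y"
      then have h: "h \<in> ?S" "\<not> (X0 h = - Y0 h \<and> X0 h \<noteq> 0)"
        using X0(2) Y0(2) by (auto simp: deletion_def sep_def srestrict_def)
      show "srestrict ?S Z h = scomp X Y h"
        using Z(3)[OF h(2)] h(1) X0(2) Y0(2) by (simp add: srestrict_def scomp_def)
    qed
  qed
qed

text \<open>The defining property concerns cocircuits only. A nonzero entry of \<open>V\<close> at
  \<open>p\<close> or \<open>f\<close> lies in a cocircuit conformal to \<open>V\<close>, which also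
  vanishes at \<open>g\<close>.\<close>

lemma parallel_extension_covector:
  assumes ext: "parallel_extension M p N f g" and V: "V \<in> covectors N" "V g = 0"
  shows "V p = V f"
proof -
  interpret oriented_mat N
    using ext by unfold_locales (simp add: parallel_extension_def single_element_extension_def)
  have eq: "Y p = Y f" if "Y \<in> cocircuits N" "Y g = 0" for Y
    using ext that by (auto simp: parallel_extension_def)
  have same: "V p = V f" if x: "x = p \<or> x = f" "V x \<noteq> 0" for x
  proof -
    obtain Y where Y: "Y \<in> cocircuits N" "\<And>h. Y h \<noteq> 0 \<Longrightarrow> Y h = V h" "Y x \<noteq> 0"
      using conformal_cocircuit[OF V(1) x(2)] by blast
    have "Y g = 0" using Y(2)[of g] V(2) by auto
    then have "Y p = Y f" using eq Y(1) by blast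
    then have "Y p \<noteq> 0" "Y f \<noteq> 0" using x(1) Y(3) by auto
    then show ?thesis using Y(2)[of p] Y(2)[of f] \<open>Y p = Y f\<close> by simp
  qed
  show ?thesis
  proof (cases "V p = 0 \<and> V f = 0")
    case False
    then show ?thesis using same[of p] same[of f] by blast
  qed simp
qed

text \<open>Where \<open>g\<close> vanishes, \<open>p\<close> carries the entry of \<open>f\<close>,
  which justifies the relabelling. Leaving open whether \<open>S\<close> contains \<open>g\<close>
  covers both the oriented matroid with coloop \<open>g\<close> and its deletion by
  \<open>g\<close>.\<close>

lemma parallel_extension_spanning_minor:
  assumes om: "oriented_matroid M" and ext: "parallel_extension M p N f g" and "f \<noteq> g"
    and X: "X \<in> cocircuits M" "X g = 1" "X f \<noteq> 0"
    and X': "X' \<in> covectors N" "srestrict (ground M) X' = X" "X' p = 0"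
    and S: "ground N - D = S" "insert p (zeros M X) \<subseteq> S" "S \<subseteq> insert g (insert p (zeros M X))"
  shows "spanning_minor M (deletion N D) (\<lambda>x. if x = p then f else x) {g} (insert p (zeros M X))"
proof -
  let ?H = "insert p (zeros M X)"
  interpret M: oriented_mat M by unfold_locales fact
  interpret N: oriented_mat N
    using ext by unfold_locales (simp add: parallel_extension_def single_element_extension_def)
  interpret P: oriented_mat "deletion N D"
    by unfold_locales (rule oriented_matroid_deletion[OF N.om])
  have p: "p \<notin> ground M" and gN: "ground N = insert p (ground M)" and del: "deletion N {p} = M"
    using ext by (auto simp: parallel_extension_def single_element_extension_def)
  have covM: "covectors M = srestrict (ground M) ` covectors N"
  proof -
    have "covectors (deletion N {p}) = srestrict (ground N - {p}) ` covectors N"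
      by (simp add: deletion_def)
    then show ?thesis using del gN p by simp
  qed
  have covP: "covectors (deletion N D) = srestrict S ` covectors N"
    and gP: "ground (deletion N D) = S"
    using S(1) by (auto simp: deletion_def)
  note par = parallel_extension_covector[OF ext]
  have fg: "f \<in> ground M" "g \<in> ground M"
    using X M.covector_outside[OF M.cocircuit_covector[OF X(1)]] by force+
  then have ne: "f \<noteq> p" "g \<noteq> p" using p by auto
  have nz: "f \<notin> zeros M X" "g \<notin> zeros M X" "p \<notin> zeros M X" using X p by (auto simp: zeros_def)
  have X'H: "X' x = 0" if "x \<in> ?H" for x
    using that X'(2,3) by (auto simp: zeros_def srestrict_def)
  have X'g: "X' g = 1" using X'(2) X(2) fg(2) by (auto simp: srestrict_def)
  \<comment> \<open>\<open>X'\<close> vanishes on \<open>?H\<close>, so it can be used to eliminate \<open>g\<close> without changing the entries there.\<close>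
  have clear_g: "\<exists>U\<in>covectors N. U g = 0 \<and> (\<forall>x\<in>?H. U x = W x)" if W: "W \<in> covectors N" for W
  proof (cases "W g = 0")
    case True
    then show ?thesis using W by blast
  next
    case False
    define Y where "Y = (if W g = 1 then - X' else X')"
    have Y: "Y \<in> covectors N" "W g = - Y g" "\<And>x. x \<in> ?H \<Longrightarrow> Y x = 0"
      using X'(1) N.covector_uminus X'g N.covector_sign[OF W, of g] False X'H by (auto simp: Y_def)
    obtain Z where Z: "Z \<in> covectors N" "Z g = 0"
        "\<And>h. \<not> (W h = - Y h \<and> W h \<noteq> 0) \<Longrightarrow> Z h = scomp W Y h"
      using N.eliminate[OF W Y(1,2) False] by blast
    have "Z x = W x" if "x \<in> ?H" for x
      using Z(3)[of x] Y(3)[OF that] by (simp add: scomp_def)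
    then show ?thesis using Z(1,2) by blast
  qed
  show ?thesis
  proof unfold_locales
    show "?H \<subseteq> ground (deletion N D)" using S(2) gP by simp
    show "(\<lambda>x. if x = p then f else x) ` ?H \<subseteq> ground M - {g}"
      using fg nz \<open>f \<noteq> g\<close> by (auto simp: zeros_def)
    show "inj_on (\<lambda>x. if x = p then f else x) ?H" using nz by (auto simp: inj_on_def)
  next
    fix V assume V: "V \<in> covectors M" "\<forall>g\<in>{g}. V g = 0"
    obtain V0 where V0: "V0 \<in> covectors N" "V = srestrict (ground M) V0" using V(1) covM by blast
    have "V0 g = 0" using V(2) V0(2) fg(2) by (simp add: srestrict_def)
    then have "V0 p = V f" using par[OF V0(1)] V0(2) fg(1) by (simp add: srestrict_def)
    \<comment> \<open>Outside \<open>?H\<close>, the set \<open>S\<close> can contain only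
      \<open>g\<close>, where \<open>V0\<close> is zero.\<close>
    then have "(\<lambda>x. if x \<in> ?H then V (if x = p then f else x) else 0) = srestrict S V0"
      using V0(2) \<open>V0 g = 0\<close> S(2,3) by (auto simp: srestrict_def zeros_def fun_eq_iff)
    then show "(\<lambda>x. if x \<in> ?H then V (if x = p then f else x) else 0) \<in> covectors (deletion N D)"
      using covP V0(1) by simp
  next
    fix W assume "W \<in> covectors (deletion N D)"
    then obtain W0 where W0: "W0 \<in> covectors N" "W = srestrict S W0" using covP by blast
    obtain U where U: "U \<in> covectors N" "U g = 0" "\<forall>x\<in>?H. U x = W0 x" using clear_g[OF W0(1)] by blast
    show "\<exists>V\<in>covectors M. (\<forall>g\<in>{g}. V g = 0) \<and> (\<forall>x\<in>?H. V (if x = p then f else x) = W x)"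
    proof (intro bexI conjI)
      show "srestrict (ground M) U \<in> covectors M" using covM U(1) by simp
      show "\<forall>g\<in>{g}. srestrict (ground M) U g = 0" using U(2) by (simp add: srestrict_def)
      show "\<forall>x\<in>?H. srestrict (ground M) U (if x = p then f else x) = W x"
        using U(3) par[OF U(1,2)] W0(2) S(2) fg(1) p by (auto simp: srestrict_def zeros_def)
    qed
  next
    fix V e assume V: "V \<in> covectors M" "\<forall>g\<in>{g}. V g = 0"
      "\<forall>x\<in>?H. V (if x = p then f else x) = 0"
    \<comment> \<open>Thus \<open>V\<close> vanishes on \<open>z(X)\<close> and at \<open>g\<close>,
      an element of the support of the cocircuit \<open>X\<close>.\<close>
    have "V x = 0" if "X x = 0" for x
    proof (cases "x \<in> ground M")
      case True
      then have "x \<in> ?H" "x \<noteq> p" using that p by (auto simp: zeros_def)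
      then show ?thesis using V(3) by auto
    next
      case False
      then show ?thesis using M.covector_outside[OF V(1)] by blast
    qed
    then show "V e = 0"
      by (rule M.cocircuit_minimal[OF X(1) V(1), of g]) (use X(2) V(2) in auto)
  qed
qed

section \<open>Euclideanness of the deletions\<close>

theorem theorem6p15:
  fixes M1 N M2 M3 :: "'a orimat" and f g f' :: 'a and X X' :: "'a svec" and r :: nat
  assumes "oriented_matroid M1" and "om_rank M1 = r"
    and "f \<noteq> g" and "general_position M1 f" and "general_position M1 g"
    and "X \<in> cocircuits M1" and "X g = 1" and "X f \<noteq> 0"
    and "parallel_extension M1 f' N f g"
    and "X' \<in> cocircuits N" and "srestrict (ground M1) X' = X" and "X' f' = 0"
    and "M2 = deletion N {f}"
    and "M3 = deletion M2 (supp (srestrict (ground M2) X') - {g})"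
  shows "(euclidean_om M1 \<longrightarrow> euclidean_om M3) \<and>
    (\<forall>e\<in>zeros M1 X. euclidean_program M1 e f \<longrightarrow> euclidean_program (deletion M3 {g}) e f')"
proof -
  define H where "H = insert f' (zeros M1 X)"
  define \<phi> where "\<phi> x = (if x = f' then f else x)" for x
  define D where "D = {f} \<union> (supp (srestrict (ground M2) X') - {g})"
  define K where "K = deletion M3 {g}"
  have N: "oriented_matroid N" and f': "f' \<notin> ground M1" and gN: "ground N = insert f' (ground M1)"
    using assms(9) by (auto simp: parallel_extension_def single_element_extension_def)
  interpret M1: oriented_mat M1 by unfold_locales fact
  interpret N: oriented_mat N by unfold_locales fact
  have X': "X' \<in> covectors N" by (rule N.cocircuit_covector) fact
  have fg: "f \<in> ground M1" "g \<in> ground M1"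
    using assms(6-8) M1.covector_outside[OF M1.cocircuit_covector] by force+
  have X'_eq: "X' x = X x" if "x \<in> ground M1" for x
    using assms(11) that by (auto simp: srestrict_def)
  have gM2: "ground M2 = insert f' (ground M1) - {f}" using assms(13) gN by (simp add: deletion_def)
  have M3: "M3 = deletion N D" and K: "K = deletion N (D \<union> {g})"
    unfolding K_def D_def assms(14) assms(13) deletion_deletion by (simp_all add: Un_assoc)
  \<comment> \<open>Since \<open>X'\<close> agrees with \<open>X\<close> on the old elements and
    vanishes at \<open>f'\<close>, deleting its support except \<open>g\<close> leaves
    \<open>z(X)\<close>, \<open>f'\<close> and \<open>g\<close>.\<close>
  have S3: "ground N - D = insert g H"
    using gN gM2 fg f' X'_eq assms(3,7,8,12)
    by (auto simp: D_def H_def supp_def srestrict_def zeros_def split: if_splits)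
  have gH: "g \<notin> H" using assms(7) fg f' by (auto simp: H_def zeros_def)
  have SK: "ground N - (D \<union> {g}) = H" using S3 gH by blast
  have minor: "spanning_minor M1 (deletion N D') \<phi> {g} H"
    if "ground N - D' = S" "H \<subseteq> S" "S \<subseteq> insert g H" for D' S
    using parallel_extension_spanning_minor[OF assms(1,9,3,6,7,8) X' assms(11,12), of D' S] that
    unfolding H_def \<phi>_def by blast
  interpret M3: spanning_minor M1 M3 \<phi> "{g}" H unfolding M3 by (rule minor[OF S3]) auto
  interpret K: spanning_minor M1 K \<phi> "{g}" H unfolding K by (rule minor[OF SK]) auto
  have gM3: "ground M3 = insert g H" using S3 by (simp add: M3 deletion_def)
  have gK: "ground K = H" using SK by (simp add: K deletion_def)
  have \<phi>H: "\<phi> x = x" if "x \<in> zeros M1 X" for x using that f' by (auto simp: \<phi>_def zeros_def)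

  \<comment> \<open>The restriction of \<open>X'\<close> to \<open>M3\<close> is supported by \<open>g\<close> alone, so \<open>g\<close> is a coloop of \<open>M3\<close>.\<close>
  define C where "C = srestrict (insert g H) X'"
  have C: "C \<in> covectors M3" using X' S3 by (auto simp: C_def M3 deletion_def)
  have C0: "C x = 0" if "x \<noteq> g" for x
    using that assms(12) X'_eq by (auto simp: C_def srestrict_def H_def zeros_def)
  have Cg: "C g = 1" using X'_eq fg assms(7) by (simp add: C_def srestrict_def)
  have cocircuit_g: "W x = 0" if W: "W \<in> cocircuits M3" "W g \<noteq> 0" "x \<noteq> g" for W x
  proof (rule ccontr)
    assume "W x \<noteq> 0"
    then have "C g = 0"
      using M3.P.cocircuit_minimal[OF W(1) C, of x g] C0 W(2,3) by metis
    with Cg show False by simp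
  qed

  have "euclidean_om M3" if eu: "euclidean_om M1"
    unfolding euclidean_om_def
  proof (intro conjI allI impI)
    show "oriented_matroid M3" by (rule M3.P.om)
    fix a b assume prog: "om_program M3 a b"
    \<comment> \<open>The covector \<open>C\<close> shows that \<open>g\<close> is a coloop, which
      cannot be the second element of a program.\<close>
    have "b \<noteq> g"
    proof
      assume "b = g"
      have "\<forall>s\<in>ground M3 - {g}. C s = 0" "C g \<noteq> 0" using C0 Cg by auto
      then have "g \<notin> closure M3 (ground M3 - {g})" using C unfolding closure_def by blast
      then show False using prog \<open>b = g\<close> by (auto simp: om_program_def coloop_def)
    qed
    then have bH: "b \<in> H" using prog gM3 by (auto simp: om_program_def)
    have "\<not> (\<exists>p n. directed_cycle M3 a b p n)"
    proof
      assume cycle: "\<exists>p n. directed_cycle M3 a b p n"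
      show False
      proof (cases "a = g")
        case True
        from cycle obtain Y Z where "(Y, Z) \<in> strict_edges M3 a b"
          unfolding directed_cycle_iff by blast
        then have YZ: "Y \<in> cocircuits M3" "Z \<in> cocircuits M3" "Y g = 1" "Z g = 1" "Y \<noteq> Z"
          by (auto simp: strict_edges_def Gf_edge_def Gf_vertices_def comodular_def True)
        \<comment> \<open>Vertices are supported on \<open>g\<close> alone with value
          \<open>1\<close>, so there is just one, but an edge joins distinct cocircuits.\<close>
        have "Y x = Z x" for x
          using cocircuit_g[OF YZ(1)] cocircuit_g[OF YZ(2)] YZ(3,4) by (cases "x = g") auto
        then show False using YZ(5) by blast
      next
        case False
        then have aH: "a \<in> H" using prog gM3 by (auto simp: om_program_def)
        \<comment> \<open>A cocircuit that is nonzero at \<open>g\<close> is supported on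
          \<open>g\<close> alone, so one that is nonzero at \<open>a\<close> vanishes at
          \<open>g\<close>.\<close>
        have supp_H: "W x = 0" if "W \<in> cocircuits M3" "W a = 1" "x \<notin> H" for W x
        proof (cases "x = g")
          case True
          then show ?thesis using cocircuit_g[OF that(1), of a] that(2) False by auto
        next
          case False
          then show ?thesis
            using M3.P.covector_outside[OF M3.P.cocircuit_covector[OF that(1)]] gM3 that(3) by blast
        qed
        have "\<exists>p n. directed_cycle M1 (\<phi> a) (\<phi> b) p n"
          by (rule M3.lift_directed_cycle[OF aH bH _ cycle]) (rule supp_H)
        moreover have "om_program M1 (\<phi> a) (\<phi> b)" by (rule M3.lift_program[OF aH bH prog])
        ultimately show False using eu by (auto simp: euclidean_om_def euclidean_program_def)
      qed
    qed
    then show "euclidean_program M3 a b" using prog by (simp add: euclidean_program_def)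
  qed
  moreover have "euclidean_program K e f'" if e: "e \<in> zeros M1 X" and eu: "euclidean_program M1 e f"
    for e
  proof -
    have eH: "e \<in> H" "f' \<in> H" using e by (auto simp: H_def)
    have "e \<noteq> f'" using e f' by (auto simp: zeros_def)
    have "\<not> loop K e"
    proof -
      obtain V where V: "V \<in> covectors M1" "V e \<noteq> 0"
        using eu by (auto simp: euclidean_program_def om_program_def loop_def closure_def)
      have "deletion N {f'} = M1"
        using assms(9) by (simp add: parallel_extension_def single_element_extension_def)
      then obtain V0 where V0: "V0 \<in> covectors N" "V = srestrict (ground N - {f'}) V0"
        using V(1) by (auto simp: deletion_def)
      have "srestrict H V0 \<in> covectors K" using V0(1) SK by (auto simp: K deletion_def)
      moreover have "srestrict H V0 e \<noteq> 0"
        using V(2) V0(2) eH by (auto simp: srestrict_def split: if_splits)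
      ultimately show ?thesis by (auto simp: loop_def closure_def)
    qed
    \<comment> \<open>A covector of \<open>K\<close> supported at \<open>f'\<close> alone would lift
      to one vanishing on \<open>z(X)\<close> and at \<open>g\<close>, hence to zero, despite its
      entry at \<open>f\<close>.\<close>
    moreover have "\<not> coloop K f'"
    proof
      assume "coloop K f'"
      then obtain W where W: "W \<in> covectors K" "\<forall>s\<in>H - {f'}. W s = 0" "W f' \<noteq> 0"
        using gK by (auto simp: coloop_def closure_def)
      obtain V where V: "V \<in> covectors M1" "V g = 0" "\<forall>x\<in>H. V (\<phi> x) = W x"
        using K.lift[OF W(1)] by blast
      have "V x = 0" if "X x = 0" for x
      proof (cases "x \<in> ground M1")
        case True
        then have x: "x \<in> zeros M1 X" using that by (simp add: zeros_def)
        then have "x \<in> H - {f'}" using f' True by (auto simp: H_def)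
        then show ?thesis using V(3) W(2) \<phi>H[OF x] by force
      next
        case False
        then show ?thesis using M1.covector_outside[OF V(1)] by blast
      qed
      then have "V f = 0"
        by (rule M1.cocircuit_minimal[OF assms(6) V(1), of g]) (use assms(7) V(2) in auto)
      then show False using V(3) W(3) eH(2) by (auto simp: \<phi>_def)
    qed
    ultimately have "om_program K e f'"
      using K.P.om eH gK \<open>e \<noteq> f'\<close> by (simp add: om_program_def)
    moreover have "\<not> (\<exists>p n. directed_cycle K e f' p n)"
    proof
      assume cycle: "\<exists>p n. directed_cycle K e f' p n"
      have supp_H: "W x = 0" if "W \<in> cocircuits K" "W e = 1" "x \<notin> H" for W x
        using K.P.covector_outside[OF K.P.cocircuit_covector[OF that(1)]] gK that(3) by blast
      have "\<exists>p n. directed_cycle M1 (\<phi> e) (\<phi> f') p n"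
        by (rule K.lift_directed_cycle[OF eH _ cycle]) (rule supp_H)
      then have "\<exists>p n. directed_cycle M1 e f p n" using \<phi>H[OF e] by (simp add: \<phi>_def)
      then show False using eu by (simp add: euclidean_program_def)
    qed
    ultimately show ?thesis by (simp add: euclidean_program_def)
  qed
  ultimately show ?thesis unfolding K_def by blast
qed

end
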